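(* Let $k\ge \ell \ge 2$ be integers. Let $\varepsilon \in \left(0,\frac{1}{6k}\right)$ and let $G$ be a graph with $d=\mathrm{d}(G) \ge 1/\varepsilon$. Then $G$ contains at least one of the following: (i) a subgraph $H$ with $|V(H)|\le 3k^3d$ and $|E(H)|\ge \varepsilon^2d^2/2$, or (ii) an $(\ell+1)$-bounded minor $G'$ with $\mathrm{d}(G') \ge \frac{\ell}{2} (1-6k\varepsilon) d$, or (iii) a $k$-bounded minor $G'$ with $\mathrm{d}(G') \ge \frac{k}{8\ell} (1-2k\varepsilon) d$.
   Context: All graphs are finite and simple. $|V(G)|$, $|E(G)|$ are the numbers of vertices and edges, and $\mathrm{d}(G)=|E(G)|/|V(G)|$ is the density. A graph $H$ is a $k$-bounded minor of $G$ if there is a model of $H$ in $G$ (pairwise disjoint vertex sets inducing connected subgraphs, one per vertex of $H$, with adjacent branch sets for every edge of $H$) in which every branch set has at most $k$ vertices; i.e. $H$ is obtained from a subgraph of $G$ by contracting connected subgraphs on at most $k$ vertices. *)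

theory Defs
  imports Complex_Main "HOL-Library.Disjoint_Sets" "Graph_Theory.Graph_Theory"
begin

(* A finite simple graph is a pair_graph, i.e. a finite, loop-free, symmetric digraph. Each
   undirected edge uv is represented by the two arcs (u, v) and (v, u), so edges are counted as
   unordered pairs of end vertices. *)
definition edges :: "'a pair_pre_digraph \<Rightarrow> 'a set set" where
  "edges G = (\<lambda>(u, v). {u, v}) ` parcs G"

definition density :: "'a pair_pre_digraph \<Rightarrow> real" where
  "density G = real (card (edges G)) / real (card (pverts G))"

(* Branch sets are non-empty, since Digraph_Component.connected fails for the empty graph.
   The qualified name distinguishes it from topological connectedness. *)
definition minor_model ::
  "('b \<Rightarrow> 'a set) \<Rightarrow> 'b pair_pre_digraph \<Rightarrow> 'a pair_pre_digraph \<Rightarrow> bool" where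
  "minor_model B H G \<longleftrightarrow>
     (\<forall>x \<in> pverts H. B x \<subseteq> pverts G \<and> Digraph_Component.connected (with_proj G \<restriction> B x)) \<and>
     disjoint_family_on B (pverts H) \<and>
     (\<forall>(x, y) \<in> parcs H. \<exists>u \<in> B x. \<exists>v \<in> B y. (u, v) \<in> parcs G)"

definition bounded_minor ::
  "nat \<Rightarrow> 'b pair_pre_digraph \<Rightarrow> 'a pair_pre_digraph \<Rightarrow> bool" where
  "bounded_minor k H G \<longleftrightarrow> (\<exists>B. minor_model B H G \<and> (\<forall>x \<in> pverts H. card (B x) \<le> k))"

end

theory Submission
  imports Defs
begin

text \<open>
  Pass to a minimal subgraph with vertex set V and density at least d, where all degrees exceed d,
  and call a vertex small if its degree is at most 3kd. Call y a mate of c if the closed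
  neighbourhood of c contains at least \<^term>\<open>\<epsilon> * d\<close> neighbours of y. A class of fewer than k
  contracted small vertices with \<^term>\<open>\<epsilon> * d\<close> adjacent mates yields outcome (i), so in all
  contractions below a vertex has few mates, and merging two adjacent non-mates loses at most
  \<^term>\<open>\<epsilon> * d\<close> edges.

  Grow search trees on T = k - r small vertices, r being k / (4l) rounded up, by depth-first search
  along non-mates of the contracted tree. When a tree is complete its stack is a path; let D be the
  set of vertices abandoned by backtracking. Abandoned vertices have few neighbours in D, and the
  edges lost by contracting all trees are few.

  If D is small, cut the paths into pieces of at most l + 1 vertices and contract them: the pieces
  refine the trees, so almost all edges survive on at most 2|V|/l vertices, which is (ii).
  Otherwise most vertices of D see almost d distinct paths or large-degree vertices, and D has more
  than r vertices for each of these. Augmenting paths attach exactly r pairwise non-mate vertices of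
  D to each member of a suitable subfamily that contains almost all neighbours of the attached
  vertices. Contracting these stars gives a k-bounded minor of density about rd/2, which is (iii).
\<close>

section \<open>Simple graphs as symmetric arc relations\<close>

text \<open>The argument moves between subgraphs, quotients and graphs on branch sets, whose
  vertices have different types, so it works with bare relations. An edge counts as two arcs;
  density at least d thus reads as at least \<open>2 * d * card V\<close> arcs.\<close>

locale simple_arcs =
  fixes V :: "'a set" and A :: "'a rel"
  assumes finite_V: "finite V"
    and arcs_subset: "A \<subseteq> V \<times> V"
    and sym_A: "sym A"
    and irrefl_A: "irrefl A"
begin

lemma finite_A: "finite A"
  using finite_V arcs_subset finite_subset by blast

lemma arcD: "(u, v) \<in> A \<Longrightarrow> u \<in> V" "(u, v) \<in> A \<Longrightarrow> v \<in> V"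
  using arcs_subset by auto

lemma arc_sym: "(u, v) \<in> A \<Longrightarrow> (v, u) \<in> A"
  using sym_A by (rule symD)

lemma arc_neq: "(u, v) \<in> A \<Longrightarrow> u \<noteq> v"
  using irrefl_A by (auto simp: irrefl_def)

lemma finite_nbrs: "finite (A `` X)"
  using finite_A by auto

lemma induced_simple_arcs: "W \<subseteq> V \<Longrightarrow> simple_arcs W (A \<inter> W \<times> W)"
  using finite_V finite_subset sym_A irrefl_A
  by unfold_locales (auto simp: sym_def irrefl_def)

end

lemma pair_graph_iff_simple_arcs: "pair_graph G \<longleftrightarrow> simple_arcs (pverts G) (parcs G)"
proof
  assume "pair_graph G"
  then interpret pair_graph G .
  show "simple_arcs (pverts G) (parcs G)"
    using pair_finite_verts in_arcsD1 in_arcsD2 pair_sym_arcs pair_no_loops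
    by unfold_locales (auto simp: symmetric_def irrefl_def, fastforce)
next
  assume "simple_arcs (pverts G) (parcs G)"
  then interpret simple_arcs "pverts G" "parcs G" .
  show "pair_graph G"
    using finite_V finite_A arcD arc_neq sym_A
    by unfold_locales (auto simp: symmetric_def)
qed

text \<open>Without loops, sending an arc to the pair of its ends is exactly two-to-one.\<close>

lemma card_parcs_eq:
  assumes "pair_graph G"
  shows "card (parcs G) = 2 * card (edges G)"
proof -
  interpret simple_arcs "pverts G" "parcs G"
    using assms by (simp add: pair_graph_iff_simple_arcs)
  let ?f = "\<lambda>(u, v). {u, v}"
  let ?fib = "\<lambda>e. {a \<in> parcs G. ?f a = e}"
  have fib: "card (?fib e) = 2" if e: "e \<in> edges G" for e
  proof -
    obtain u v where uv: "(u, v) \<in> parcs G" "e = {u, v}"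
      using e by (auto simp: edges_def)
    then have "?fib e = {(u, v), (v, u)}"
      using arc_sym by (fastforce simp: doubleton_eq_iff)
    then show ?thesis using arc_neq[OF uv(1)] by simp
  qed
  have "card (parcs G) = card (\<Union>e\<in>edges G. ?fib e)"
    by (rule arg_cong[where f = card]) (auto simp: edges_def)
  also have "\<dots> = (\<Sum>e\<in>edges G. card (?fib e))"
    using finite_A by (intro card_UN_disjoint) (auto simp: edges_def)
  finally have "card (parcs G) = (\<Sum>e\<in>edges G. card (?fib e))" .
  then show ?thesis using fib by simp
qed

lemma density_eq_arcs:
  assumes "pair_graph G"
  shows "density G = real (card (parcs G)) / (2 * real (card (pverts G)))"
  using card_parcs_eq[OF assms] by (simp add: density_def)

section \<open>Connected sets and minors given by families of branch sets\<close>

inductive_set tree_sets :: "'a rel \<Rightarrow> 'a set set" for A where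
  singleton: "{x} \<in> tree_sets A"
| insert: "S \<in> tree_sets A \<Longrightarrow> s \<in> S \<Longrightarrow> (s, y) \<in> A \<Longrightarrow> insert y S \<in> tree_sets A"

lemma tree_sets_nonempty: "S \<in> tree_sets A \<Longrightarrow> S \<noteq> {}"
  by (induction rule: tree_sets.induct) auto

text \<open>The inserted vertex reaches all others, and is reached by them, through the vertex
  \<open>s\<close> to which it was attached. The symmetric closure matches the notion of
  connectedness used for branch sets.\<close>

lemma tree_sets_reach:
  assumes "S \<in> tree_sets A"
  shows "u \<in> S \<Longrightarrow> v \<in> S \<Longrightarrow> (u, v) \<in> rtrancl_on S ((A \<inter> S \<times> S)\<^sup>s)"
  using assms
proof (induction arbitrary: u v rule: tree_sets.induct)
  case (singleton x)
  then show ?case by auto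
next
  case (insert S s y)
  let ?S = "insert y S"
  let ?R = "rtrancl_on ?S ((A \<inter> ?S \<times> ?S)\<^sup>s)"
  have mono: "(a, b) \<in> ?R" if "a \<in> S" "b \<in> S" for a b
  proof -
    have "(a, b) \<in> rtrancl_on S ((A \<inter> S \<times> S)\<^sup>s)" using insert.IH that by blast
    then show ?thesis
      by (induction rule: rtrancl_on.induct)
        (auto simp: symcl_def intro: rtrancl_on.rtrancl_on_into_rtrancl_on)
  qed
  have sy: "(s, y) \<in> (A \<inter> ?S \<times> ?S)\<^sup>s" "(y, s) \<in> (A \<inter> ?S \<times> ?S)\<^sup>s"
    using insert.hyps by (auto simp: symcl_def)
  have to_y: "(a, y) \<in> ?R" if "a \<in> S" for a
    using mono[OF that insert.hyps(2)] sy(1)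
    by (rule rtrancl_on.rtrancl_on_into_rtrancl_on) simp
  have "(y, y) \<in> ?R" by simp
  then have "(y, s) \<in> ?R"
    using sy(2) by (rule rtrancl_on.rtrancl_on_into_rtrancl_on) (simp add: insert.hyps(2))
  then have from_y: "(y, a) \<in> ?R" if "a \<in> S" for a
    using mono[OF insert.hyps(2) that] by (rule rtrancl_on_trans)
  show ?case
    using insert.prems mono to_y from_y \<open>(y, y) \<in> ?R\<close> by blast
qed

lemma tree_sets_connected:
  assumes "S \<in> tree_sets A" and "A \<subseteq> parcs G"
  shows "Digraph_Component.connected (with_proj G \<restriction> S)"
proof -
  let ?G = "with_proj G \<restriction> S"
  have sub: "(A \<inter> S \<times> S)\<^sup>s \<subseteq> (arcs_ends ?G)\<^sup>s"
    using assms(2) by (force simp: symcl_def arcs_ends_conv)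
  have "(u, v) \<in> rtrancl_on S ((arcs_ends ?G)\<^sup>s)" if "u \<in> S" "v \<in> S" for u v
    using tree_sets_reach[OF assms(1) that] sub by (rule rtrancl_on_mono[rotated -1]) auto
  then show ?thesis
    using tree_sets_nonempty[OF assms(1)] by (auto simp: connected_conv)
qed

text \<open>The minor must again have vertices of type \<open>'a\<close>, while the families built
  below are indexed by vertex sets. So each branch set is named by a vertex chosen from it, and
  disjointness keeps the names distinct. \<open>R\<close> may omit adjacencies.\<close>

lemma bounded_minor_of_family:
  fixes G :: "'a pair_pre_digraph" and B :: "'i \<Rightarrow> 'a set"
  assumes "A \<subseteq> parcs G" and "simple_arcs I R"
    and tree: "\<And>i. i \<in> I \<Longrightarrow> B i \<in> tree_sets A"
    and sub: "\<And>i. i \<in> I \<Longrightarrow> B i \<subseteq> pverts G"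
    and size: "\<And>i. i \<in> I \<Longrightarrow> card (B i) \<le> s"
    and disj: "disjoint_family_on B I"
    and adj: "\<And>i j. (i, j) \<in> R \<Longrightarrow> \<exists>u\<in>B i. \<exists>v\<in>B j. (u, v) \<in> A"
  shows "\<exists>G' :: 'a pair_pre_digraph. pair_graph G' \<and> bounded_minor s G' G \<and>
    density G' = real (card R) / (2 * real (card I))"
proof -
  interpret R: simple_arcs I R by fact
  define rep where "rep i = (SOME u. u \<in> B i)" for i
  have rep: "rep i \<in> B i" if "i \<in> I" for i
    using tree_sets_nonempty[OF tree[OF that]] by (auto simp: rep_def some_in_eq)
  have inj: "inj_on rep I"
    using rep disj by (fastforce simp: inj_on_def disjoint_family_on_def)
  define \<rho> where "\<rho> = the_inv_into I rep"
  have \<rho>: "\<rho> (rep i) = i" if "i \<in> I" for i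
    using inj that by (simp add: \<rho>_def the_inv_into_f_f)
  define G' where "G' = \<lparr>pverts = rep ` I, parcs = map_prod rep rep ` R\<rparr>"
  have G': "pair_graph G'"
    unfolding pair_graph_iff_simple_arcs
  proof
    show "finite (pverts G')" using R.finite_V by (simp add: G'_def)
    show "parcs G' \<subseteq> pverts G' \<times> pverts G'" using R.arcD by (auto simp: G'_def)
    show "sym (parcs G')" using R.arc_sym by (force simp: G'_def sym_def)
    show "irrefl (parcs G')"
      using R.arcD R.arc_neq inj by (auto simp: G'_def irrefl_def inj_on_def, blast)
  qed
  have "card (map_prod rep rep ` R) = card R"
    using R.arcs_subset inj by (intro card_image inj_on_subset[OF map_prod_inj_on[OF inj inj]])
  then have dens: "density G' = real (card R) / (2 * real (card I))"
    using density_eq_arcs[OF G'] card_image[OF inj] by (simp add: G'_def)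
  have "minor_model (\<lambda>u. B (\<rho> u)) G' G"
    unfolding minor_model_def
  proof (intro conjI)
    show "\<forall>x\<in>pverts G'. B (\<rho> x) \<subseteq> pverts G \<and>
        Digraph_Component.connected (with_proj G \<restriction> B (\<rho> x))"
      using \<rho> sub tree tree_sets_connected[OF _ assms(1)] by (auto simp: G'_def)
    show "disjoint_family_on (\<lambda>u. B (\<rho> u)) (pverts G')"
      using disj \<rho> unfolding disjoint_family_on_def G'_def by force
    show "\<forall>(x, y)\<in>parcs G'. \<exists>u\<in>B (\<rho> x). \<exists>v\<in>B (\<rho> y). (u, v) \<in> parcs G"
    proof (clarify)
      fix x y assume "(x, y) \<in> parcs G'"
      then obtain i j where ij: "(i, j) \<in> R" "x = rep i" "y = rep j" by (auto simp: G'_def)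
      then show "\<exists>u\<in>B (\<rho> x). \<exists>v\<in>B (\<rho> y). (u, v) \<in> parcs G"
        using adj[OF ij(1)] \<rho> R.arcD[OF ij(1)] assms(1) by auto
    qed
  qed
  moreover have "\<forall>x\<in>pverts G'. card (B (\<rho> x)) \<le> s"
    using size \<rho> by (auto simp: G'_def)
  ultimately have "bounded_minor s G' G" unfolding bounded_minor_def by blast
  then show ?thesis using G' dens by blast
qed

text \<open>The form in which outcome (i) is reached: \<open>2 * b\<close> arcs inside
  \<open>W\<close> are \<open>b\<close> edges of the induced subgraph.\<close>

lemma (in simple_arcs) dense_subgraph:
  assumes "pair_graph G" and "V \<subseteq> pverts G" and "A \<subseteq> parcs G" and "W \<subseteq> V"
    and "real (card W) \<le> a" and "2 * b \<le> real (card (A \<inter> W \<times> W))"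
  shows "\<exists>H :: 'a pair_pre_digraph. pair_graph H \<and> subgraph (with_proj H) (with_proj G) \<and>
    real (card (pverts H)) \<le> a \<and> b \<le> real (card (edges H))"
proof -
  define H where "H = \<lparr>pverts = W, parcs = A \<inter> W \<times> W\<rparr>"
  have H: "pair_graph H"
    using induced_simple_arcs[OF assms(4)] by (simp add: pair_graph_iff_simple_arcs H_def)
  interpret H: pair_graph H by fact
  interpret G: pair_graph G by fact
  have "subgraph (with_proj H) (with_proj G)"
    using assms(2-4) H.wf_digraph G.wf_digraph by (auto simp: subgraph_def H_def compatible_def)
  then show ?thesis
    using H assms(5,6) card_parcs_eq[OF H] by (auto simp: H_def)
qed

section \<open>Packing stars into a bipartite graph\<close>

text \<open>Points of \<open>X\<close> are to be attached to neighbouring centres in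
  \<open>Z\<close>, at most \<open>r\<close> to each and never two mates to the same one.
  \<open>large_X\<close> forces some point to stay unattached; \<open>few_mates\<close> ensures that
  mates cannot block all centres of a point.\<close>

locale star_packing =
  fixes X :: "'x set" and Z :: "'z set" and N :: "'x \<Rightarrow> 'z set"
    and mate :: "'x \<Rightarrow> 'x \<Rightarrow> bool" and r :: nat
  assumes finite_X: "finite X" and finite_Z: "finite Z"
    and N_subset: "x \<in> X \<Longrightarrow> N x \<subseteq> Z"
    and mate_sym: "mate x y \<Longrightarrow> mate y x"
    and few_mates: "x \<in> X \<Longrightarrow> card {y \<in> X. mate x y} < card (N x)"
    and large_X: "r * card Z < card X"
begin

text \<open>Only mates block a centre, not saturation; the capacity \<open>r\<close> is treated
  separately. The point itself is exempt, so that the condition also makes sense for a point already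
  placed at \<open>z\<close>.\<close>

definition free_for :: "('x \<Rightarrow> 'z option) \<Rightarrow> 'x \<Rightarrow> 'z \<Rightarrow> bool" where
  "free_for \<phi> x z \<longleftrightarrow> z \<in> N x \<and> (\<forall>y. \<phi> y = Some z \<longrightarrow> y \<noteq> x \<longrightarrow> \<not> mate x y)"

definition packing :: "('x \<Rightarrow> 'z option) \<Rightarrow> bool" where
  "packing \<phi> \<longleftrightarrow> dom \<phi> \<subseteq> X \<and> (\<forall>x z. \<phi> x = Some z \<longrightarrow> free_for \<phi> x z) \<and>
     (\<forall>z. card {x. \<phi> x = Some z} \<le> r)"

definition maximum_packing :: "('x \<Rightarrow> 'z option) \<Rightarrow> bool" where
  "maximum_packing \<phi> \<longleftrightarrow> packing \<phi> \<and> (\<forall>\<psi>. packing \<psi> \<longrightarrow> card (dom \<psi>) \<le> card (dom \<phi>))"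

text \<open>Centres reachable from unassigned points by alternating walks with at most n reassignments.\<close>

fun reach :: "('x \<Rightarrow> 'z option) \<Rightarrow> nat \<Rightarrow> 'z set" where
  "reach \<phi> 0 = {z. \<exists>x\<in>X. \<phi> x = None \<and> free_for \<phi> x z}"
| "reach \<phi> (Suc n) = reach \<phi> n \<union> {z. \<exists>x z'. \<phi> x = Some z' \<and> z' \<in> reach \<phi> n \<and> free_for \<phi> x z}"

lemma reach_mono: "i \<le> j \<Longrightarrow> reach \<phi> i \<subseteq> reach \<phi> j"
  by (induction j) (auto simp: le_Suc_eq)

lemma finite_fibre: "packing \<phi> \<Longrightarrow> finite {x. \<phi> x = Some z}"
  using finite_X by (auto simp: packing_def dom_def intro: finite_subset)

text \<open>This covers moving an attached point as well as attaching a new one: leaving the old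
  centre only shrinks a fibre, which keeps all other points free for their centres.\<close>

lemma packing_update:
  assumes "packing \<phi>" and "x \<in> X" and "free_for \<phi> x z" and "card {y. \<phi> y = Some z} < r"
  shows "packing (\<phi>(x \<mapsto> z))"
  unfolding packing_def
proof (intro conjI allI impI)
  show "dom (\<phi>(x \<mapsto> z)) \<subseteq> X" using assms by (auto simp: packing_def)
next
  fix y w assume yw: "(\<phi>(x \<mapsto> z)) y = Some w"
  show "free_for (\<phi>(x \<mapsto> z)) y w"
  proof (cases "y = x")
    case True
    then show ?thesis using yw assms(3) by (auto simp: free_for_def)
  next
    case False
    then have "\<phi> y = Some w" using yw by simp
    then have y: "free_for \<phi> y w" using assms(1) by (auto simp: packing_def)
    moreover have "\<not> mate y x" if "w = z"
      using assms(3) \<open>\<phi> y = Some w\<close> False that mate_sym by (auto simp: free_for_def)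
    ultimately show ?thesis by (auto simp: free_for_def)
  qed
next
  fix w
  show "card {y. (\<phi>(x \<mapsto> z)) y = Some w} \<le> r"
  proof (cases "w = z")
    case True
    then have "{y. (\<phi>(x \<mapsto> z)) y = Some w} \<subseteq> insert x {y. \<phi> y = Some z}" by auto
    then have "card {y. (\<phi>(x \<mapsto> z)) y = Some w} \<le> card (insert x {y. \<phi> y = Some z})"
      using finite_fibre[OF assms(1)] by (intro card_mono) auto
    also have "\<dots> \<le> Suc (card {y. \<phi> y = Some z})" by (simp add: card_insert_le_m1 card_insert_if finite_fibre[OF assms(1)])
    finally show ?thesis using assms(4) by simp
  next
    case False
    then have "{y. (\<phi>(x \<mapsto> z)) y = Some w} \<subseteq> {y. \<phi> y = Some w}" by (auto split: if_splits)
    then have "card {y. (\<phi>(x \<mapsto> z)) y = Some w} \<le> card {y. \<phi> y = Some w}"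
      using finite_fibre[OF assms(1)] by (rule card_mono[rotated])
    also have "\<dots> \<le> r" using assms(1) by (simp add: packing_def)
    finally show ?thesis .
  qed
qed

text \<open>A walk of minimal length to an unsaturated centre could be shortened by moving its last point.\<close>

lemma reach_saturated:
  "maximum_packing \<phi> \<Longrightarrow> z \<in> reach \<phi> n \<Longrightarrow> card {x. \<phi> x = Some z} = r"
proof (induction n arbitrary: \<phi> z)
  case 0
  then obtain x where x: "x \<in> X" "\<phi> x = None" "free_for \<phi> x z" by auto
  show ?case
  proof (rule ccontr)
    assume "\<not> ?thesis"
    then have "card {x. \<phi> x = Some z} < r"
      using 0(1) by (auto simp: maximum_packing_def packing_def nat_less_le)
    then have "packing (\<phi>(x \<mapsto> z))"
      using 0(1) x by (intro packing_update) (auto simp: maximum_packing_def)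
    then have "card (dom (\<phi>(x \<mapsto> z))) \<le> card (dom \<phi>)" using 0(1) by (auto simp: maximum_packing_def)
    moreover have "finite (dom \<phi>)"
      using 0(1) finite_X by (auto simp: maximum_packing_def packing_def intro: finite_subset)
    ultimately show False using x(2) by (simp add: domIff card_insert_if)
  qed
next
  case (Suc n)
  show ?case
  proof (rule ccontr)
    assume nonfull: "\<not> ?thesis"
    have pack: "packing \<phi>" using Suc.prems(1) by (simp add: maximum_packing_def)
    \<comment> \<open>By the induction hypothesis, centres reached within \<open>n\<close>
      reassignments are saturated, so the unsaturated \<open>z\<close> needs all
      \<open>Suc n\<close> of them.\<close>
    have notin: "z \<notin> reach \<phi> j" if "j \<le> n" for j
      using Suc.IH[OF Suc.prems(1), of z] nonfull reach_mono[OF that, of \<phi>] by blast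
    then obtain x z' where x: "\<phi> x = Some z'" "z' \<in> reach \<phi> n" "free_for \<phi> x z"
      using Suc.prems(2) by auto
    have "x \<in> X" using x(1) pack by (auto simp: packing_def)
    define \<psi> where "\<psi> = \<phi>(x \<mapsto> z)"
    have "card {x. \<phi> x = Some z} < r"
      using pack nonfull by (auto simp: packing_def nat_less_le)
    then have pack': "packing \<psi>"
      unfolding \<psi>_def using pack x \<open>x \<in> X\<close> by (intro packing_update) auto
    have "dom \<psi> = dom \<phi>" using x(1) by (auto simp: \<psi>_def)
    then have max': "maximum_packing \<psi>"
      using pack' Suc.prems(1) by (auto simp: maximum_packing_def)
    have free': "free_for \<psi> y w" if "free_for \<phi> y w" "w \<noteq> z" for y w
      using that by (auto simp: free_for_def \<psi>_def)
    \<comment> \<open>The move of \<open>x\<close> only fills \<open>z\<close>, which no walk of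
      length at most \<open>n\<close> visits; every other fibre stays the same or shrinks, so those
      walks survive.\<close>
    have "reach \<phi> j \<subseteq> reach \<psi> j" if "j \<le> n" for j
      using that
    proof (induction j)
      case 0
      show ?case
      proof
        fix w assume w: "w \<in> reach \<phi> 0"
        then obtain y where y: "y \<in> X" "\<phi> y = None" "free_for \<phi> y w" by auto
        have "w \<noteq> z" using w notin[of 0] by blast
        then have "free_for \<psi> y w" using free'[OF y(3)] by blast
        moreover have "\<psi> y = None" using y(2) x(1) by (auto simp: \<psi>_def)
        ultimately show "w \<in> reach \<psi> 0" using y(1) by auto
      qed
    next
      case (Suc j)
      show ?case
      proof
        fix w assume w: "w \<in> reach \<phi> (Suc j)"
        have "w \<noteq> z" using w notin[OF Suc.prems] by blast
        consider "w \<in> reach \<phi> j" | y w' where "\<phi> y = Some w'" "w' \<in> reach \<phi> j" "free_for \<phi> y w"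
          using w by auto
        then show "w \<in> reach \<psi> (Suc j)"
        proof cases
          case 1
          then show ?thesis using Suc by auto
        next
          case 2
          \<comment> \<open>If the walk moved \<open>x\<close> itself, then \<open>z\<close> would
            be reached after \<open>Suc j\<close> steps, which is too early.\<close>
          have "y \<noteq> x"
          proof
            assume "y = x"
            then have "z \<in> reach \<phi> (Suc j)" using 2 x by auto
            then show False using notin Suc.prems by blast
          qed
          then have "\<psi> y = Some w'" using 2(1) by (simp add: \<psi>_def)
          then show ?thesis using 2 Suc free'[OF 2(3) \<open>w \<noteq> z\<close>] by auto
        qed
      qed
    qed
    then have "z' \<in> reach \<psi> n" using x(2) by blast
    \<comment> \<open>The induction hypothesis for the modified packing says that \<open>z'\<close>
      is still saturated, although it has just lost \<open>x\<close>.\<close>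
    then have "card {y. \<psi> y = Some z'} = r" using Suc.IH[OF max'] by blast
    moreover have "z \<noteq> z'" using notin[of n] x(2) by blast
    then have "{y. \<psi> y = Some z'} \<subset> {y. \<phi> y = Some z'}" using x(1) by (auto simp: \<psi>_def)
    then have "card {y. \<psi> y = Some z'} < card {y. \<phi> y = Some z'}"
      by (rule psubset_card_mono[OF finite_fibre[OF pack]])
    moreover have "card {y. \<phi> y = Some z'} \<le> r" using pack by (auto simp: packing_def)
    ultimately show False by simp
  qed
qed

lemma exists_maximum_packing: "\<exists>\<phi>. maximum_packing \<phi>"
proof -
  have "packing Map.empty" by (simp add: packing_def)
  moreover have "card (dom \<psi>) \<le> card X" if "packing \<psi>" for \<psi>
    using that finite_X by (auto simp: packing_def intro: card_mono)
  ultimately show ?thesis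
    using ex_has_greatest_nat[of packing Map.empty "\<lambda>\<psi>. card (dom \<psi>)" "Suc (card X)"]
    by (auto simp: maximum_packing_def le_imp_less_Suc)
qed

text \<open>A blocked centre carries a mate of \<open>x\<close>, and a mate sits at one centre only,
  so distinct blocked centres come from distinct mates.\<close>

lemma card_not_free:
  assumes "packing \<phi>" and "x \<in> X"
  shows "card {z \<in> N x. \<not> free_for \<phi> x z} \<le> card {y \<in> X. mate x y}"
proof (rule surj_card_le)
  show "finite {y \<in> X. mate x y}" using finite_X by simp
  show "{z \<in> N x. \<not> free_for \<phi> x z} \<subseteq> (\<lambda>y. the (\<phi> y)) ` {y \<in> X. mate x y}"
    using assms by (force simp: free_for_def packing_def dom_def)
qed

text \<open>Take the centres reachable in a maximum packing. They are saturated, whence exactly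
  \<open>r\<close> points each. A point at a reachable centre reaches every centre for which it is
  free, so only blocked neighbours can lie outside \<open>Z'\<close>. Since at most
  \<open>r * card Z\<close> points are attached, some point is unattached, and one of its centres is
  free; hence \<open>Z'\<close> is non-empty.\<close>

lemma saturated_stars:
  obtains Z' S where "Z' \<subseteq> Z" and "Z' \<noteq> {}"
    and "\<And>z. z \<in> Z' \<Longrightarrow> S z \<subseteq> X" and "\<And>z. z \<in> Z' \<Longrightarrow> card (S z) = r"
    and "disjoint_family_on S Z'"
    and "\<And>x z. z \<in> Z' \<Longrightarrow> x \<in> S z \<Longrightarrow> z \<in> N x"
    and "\<And>x y z. z \<in> Z' \<Longrightarrow> x \<in> S z \<Longrightarrow> y \<in> S z \<Longrightarrow> x \<noteq> y \<Longrightarrow> \<not> mate x y"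
    and "\<And>x z. z \<in> Z' \<Longrightarrow> x \<in> S z \<Longrightarrow> card (N x - Z') \<le> card {y \<in> X. mate x y}"
proof -
  obtain \<phi> where max: "maximum_packing \<phi>" using exists_maximum_packing by blast
  then have pack: "packing \<phi>" by (simp add: maximum_packing_def)
  define Z' where "Z' = (\<Union>n. reach \<phi> n)"
  define S where "S z = {x. \<phi> x = Some z}" for z
  have Z'_sub: "Z' \<subseteq> Z"
  proof -
    have "reach \<phi> n \<subseteq> Z" for n
      using N_subset pack by (induction n) (auto simp: free_for_def packing_def dom_def)
    then show ?thesis by (auto simp: Z'_def)
  qed
  have "Z' \<noteq> {}"
  proof -
    have "dom \<phi> \<subseteq> (\<Union>z\<in>Z. S z)"
      using pack N_subset by (fastforce simp: packing_def S_def dom_def free_for_def)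
    then have "card (dom \<phi>) \<le> card (\<Union>z\<in>Z. S z)"
      using finite_Z finite_fibre[OF pack] by (intro card_mono) (auto simp: S_def)
    also have "\<dots> \<le> (\<Sum>z\<in>Z. card (S z))" by (rule card_UN_le[OF finite_Z])
    also have "\<dots> \<le> (\<Sum>z\<in>Z. r)" using pack by (intro sum_mono) (auto simp: packing_def S_def)
    also have "\<dots> < card X" using large_X by (simp add: mult.commute)
    finally have "\<not> X \<subseteq> dom \<phi>" using pack card_mono[of "dom \<phi>" X] finite_X
      by (auto simp: packing_def intro: finite_subset)
    then obtain x where x: "x \<in> X" "\<phi> x = None" by auto
    have "card {z \<in> N x. \<not> free_for \<phi> x z} < card (N x)"
      using card_not_free[OF pack x(1)] few_mates[OF x(1)] by simp
    then have "{z \<in> N x. \<not> free_for \<phi> x z} \<noteq> N x" by auto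
    then obtain z where "z \<in> N x" "free_for \<phi> x z" by blast
    then have "z \<in> reach \<phi> 0" using x by auto
    then show ?thesis unfolding Z'_def by blast
  qed
  moreover have "card (N x - Z') \<le> card {y \<in> X. mate x y}" if z: "z \<in> Z'" and xz: "x \<in> S z" for x z
  proof -
    obtain n where n: "z \<in> reach \<phi> n" using z by (auto simp: Z'_def)
    have x: "x \<in> X" "\<phi> x = Some z" using xz pack by (auto simp: S_def packing_def)
    have "w \<in> Z'" if "free_for \<phi> x w" for w
    proof -
      have "w \<in> reach \<phi> (Suc n)" using that n x(2) by auto
      then show ?thesis unfolding Z'_def by blast
    qed
    then have "N x - Z' \<subseteq> {w \<in> N x. \<not> free_for \<phi> x w}" by auto
    then have "card (N x - Z') \<le> card {w \<in> N x. \<not> free_for \<phi> x w}"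
      using N_subset[OF x(1)] finite_Z by (intro card_mono) (auto intro: finite_subset)
    then show ?thesis using card_not_free[OF pack x(1)] by simp
  qed
  moreover have "S z \<subseteq> X" for z using pack by (auto simp: S_def packing_def)
  moreover have "card (S z) = r" if "z \<in> Z'" for z
    using that reach_saturated[OF max] by (auto simp: S_def Z'_def)
  moreover have "disjoint_family_on S Z'" by (auto simp: S_def disjoint_family_on_def)
  moreover have free: "free_for \<phi> x z" if "x \<in> S z" for x z
    using that pack by (simp add: S_def packing_def)
  moreover have "\<not> mate x y" if "x \<in> S z" "y \<in> S z" "x \<noteq> y" for x y z
    using free[OF that(1)] that by (auto simp: S_def free_for_def)
  ultimately show thesis
    using that[OF Z'_sub, of S] by (simp add: free_for_def)
qed

end

text \<open>The second Bonferroni inequality: the union is at least the sum minus all pairwise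
  intersections.\<close>

lemma card_UN_ge_sum_minus_pairs:
  fixes m :: real
  assumes "finite S" and "\<And>x. x \<in> S \<Longrightarrow> finite (F x)"
    and "\<And>x y. x \<in> S \<Longrightarrow> y \<in> S \<Longrightarrow> x \<noteq> y \<Longrightarrow> real (card (F x \<inter> F y)) \<le> m"
  shows "(\<Sum>x\<in>S. real (card (F x))) \<le>
    real (card (\<Union>x\<in>S. F x)) + m * (real (card S) * (real (card S) - 1) / 2)"
  using assms
proof (induction S rule: finite_induct)
  case empty
  then show ?case by simp
next
  case (insert x S)
  let ?U = "\<Union>y\<in>S. F y"
  have fin: "finite ?U" "finite (F x)" using insert.hyps(1) insert.prems(1) by auto
  have "card (F x \<inter> ?U) \<le> (\<Sum>y\<in>S. card (F x \<inter> F y))"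
    using card_UN_le[OF insert.hyps(1), of "\<lambda>y. F x \<inter> F y"] by simp
  then have "real (card (F x \<inter> ?U)) \<le> (\<Sum>y\<in>S. real (card (F x \<inter> F y)))"
    by (simp only: of_nat_le_iff flip: of_nat_sum)
  also have "\<dots> \<le> (\<Sum>y\<in>S. m)" using insert.prems(2) insert.hyps(2) by (intro sum_mono) blast
  finally have inter: "real (card (F x \<inter> ?U)) \<le> real (card S) * m" by simp
  have "card (F x) + card ?U = card (F x \<union> ?U) + card (F x \<inter> ?U)"
    by (rule card_Un_Int[OF fin(2,1)])
  then have un: "real (card (F x)) + real (card ?U) =
      real (card (F x \<union> ?U)) + real (card (F x \<inter> ?U))"
    by (simp only: flip: of_nat_add)
  have IH: "(\<Sum>y\<in>S. real (card (F y))) \<le>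
      real (card ?U) + m * (real (card S) * (real (card S) - 1) / 2)"
    using insert.IH insert.prems by blast
  show ?case using insert.hyps inter un IH by (simp add: field_simps)
qed

section \<open>Contracting by depth-first search\<close>

context simple_arcs
begin

text \<open>The simple graph left after identifying vertices with equal labels. It serves for
  counting only; branch sets are made elsewhere from connected sets.\<close>

definition qarcs :: "('a \<Rightarrow> 'b) \<Rightarrow> 'b rel" where
  "qarcs g = {(g u, g v) | u v. (u, v) \<in> A \<and> g u \<noteq> g v}"

lemma qarcs_subset: "qarcs g \<subseteq> map_prod g g ` A"
  by (auto simp: qarcs_def)

lemma finite_qarcs: "finite (qarcs g)"
  using finite_subset[OF qarcs_subset] finite_A by blast

lemma finite_qnbrs: "finite (qarcs g `` X)"
  by (rule finite_Image[OF finite_qarcs])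

lemma qarcs_sym: "(a, b) \<in> qarcs g \<Longrightarrow> (b, a) \<in> qarcs g"
  unfolding qarcs_def using arc_sym by fastforce

lemma qarcs_neq: "(a, b) \<in> qarcs g \<Longrightarrow> a \<noteq> b"
  by (auto simp: qarcs_def)

text \<open>Merging the singleton class \<open>y\<close> into \<open>c\<close> destroys the edge
  between them and one of the two edges to each common neighbour. These correspond to the set
  \<open>L\<close>, and each is two arcs.\<close>

lemma card_qarcs_merge:
  assumes single: "\<And>v. v \<in> V \<Longrightarrow> g v = y \<longleftrightarrow> v = y" and "c \<noteq> y"
  shows "card (qarcs g) \<le> card (qarcs (g(y := c))) +
    2 * card (qarcs g `` {y} \<inter> insert c (qarcs g `` {c}))"
proof -
  define K where "K = qarcs g"
  define L where "L = K `` {y} \<inter> insert c (K `` {c})"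
  define K' where "K' = K - ({y} \<times> L \<union> L \<times> {y})"
  define \<pi> where "\<pi> w = (if w = y then c else w)" for w
  have finL: "finite L" using finite_qnbrs by (auto simp: L_def K_def)
  have finK: "finite K" by (simp add: K_def finite_qarcs)
  have symK: "(a, b) \<in> K \<Longrightarrow> (b, a) \<in> K" and neqK: "(a, b) \<in> K \<Longrightarrow> a \<noteq> b" for a b
    by (auto simp: K_def qarcs_sym qarcs_neq)
  have y1: "b \<noteq> c" "b \<noteq> y" "(c, b) \<notin> K" "(b, c) \<notin> K" if "(y, b) \<in> K'" for b
    using that symK neqK by (auto simp: K'_def L_def)
  have y2: "b \<noteq> c" "b \<noteq> y" "(c, b) \<notin> K" "(b, c) \<notin> K" if "(b, y) \<in> K'" for b
    using that symK neqK by (auto simp: K'_def L_def)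
  have subK: "K' \<subseteq> K" by (auto simp: K'_def)
  \<comment> \<open>An arc at \<open>y\<close> that remains in \<open>K'\<close> ends in a vertex
    that is neither \<open>c\<close> nor adjacent to \<open>c\<close>, so its image coincides with
    no arc already present.\<close>
  have inj: "inj_on (map_prod \<pi> \<pi>) K'"
  proof (rule inj_onI, clarify)
    fix a b a' b' assume ab: "(a, b) \<in> K'" "(a', b') \<in> K'" and "map_prod \<pi> \<pi> (a, b) = map_prod \<pi> \<pi> (a', b')"
    then have eq: "\<pi> a = \<pi> a'" "\<pi> b = \<pi> b'" by auto
    then show "a = a' \<and> b = b'"
      using y1 y2 ab subK neqK[of b' b'] unfolding \<pi>_def
      by (cases "a = y"; cases "a' = y"; cases "b = y"; cases "b' = y") auto
  qed
  have sub: "map_prod \<pi> \<pi> ` K' \<subseteq> qarcs (g(y := c))"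
  proof
    fix e assume "e \<in> map_prod \<pi> \<pi> ` K'"
    then obtain a b where ab: "(a, b) \<in> K'" and e: "e = (\<pi> a, \<pi> b)" by auto
    then obtain u v where uv: "(u, v) \<in> A" "a = g u" "b = g v" by (auto simp: K'_def K_def qarcs_def)
    have eq: "\<pi> a = (g(y := c)) u" "\<pi> b = (g(y := c)) v"
      using uv single[of u] single[of v] arcD[OF uv(1)] by (auto simp: \<pi>_def)
    have "\<pi> a \<noteq> \<pi> b"
      using y1[of b] y2[of a] ab subK neqK[of a b] by (auto simp: \<pi>_def)
    then show "e \<in> qarcs (g(y := c))"
      unfolding e eq qarcs_def using uv(1) by blast
  qed
  have "K \<subseteq> K' \<union> ({y} \<times> L \<union> L \<times> {y})" by (auto simp: K'_def)
  then have "card K \<le> card (K' \<union> ({y} \<times> L \<union> L \<times> {y}))"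
    using finK finL by (intro card_mono) (auto simp: K'_def)
  also have "\<dots> \<le> card K' + card ({y} \<times> L \<union> L \<times> {y})" by (rule card_Un_le)
  also have "card ({y} \<times> L \<union> L \<times> {y}) \<le> card ({y} \<times> L) + card (L \<times> {y})" by (rule card_Un_le)
  also have "\<dots> = 2 * card L" by (simp add: card_cartesian_product)
  finally have "card K \<le> card K' + 2 * card L" by simp
  moreover have "card K' \<le> card (qarcs (g(y := c)))"
    using card_mono[OF finite_qarcs sub] card_image[OF inj] by simp
  ultimately show ?thesis by (simp add: K_def L_def)
qed

lemma card_class_nbrs:
  assumes "\<And>v. v \<in> V \<Longrightarrow> g v = c \<Longrightarrow> real (card (A `` {v})) \<le> \<Delta>"
  shows "real (card (qarcs g `` {c})) \<le> real (card {v \<in> V. g v = c}) * \<Delta>"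
proof -
  let ?C = "{v \<in> V. g v = c}"
  have "qarcs g `` {c} \<subseteq> g ` (\<Union>v\<in>?C. A `` {v})"
    using arcD by (fastforce simp: qarcs_def)
  moreover have fin: "finite (\<Union>v\<in>?C. A `` {v})" using finite_V finite_nbrs by auto
  ultimately have "card (qarcs g `` {c}) \<le> card (\<Union>v\<in>?C. A `` {v})"
    by (meson card_image_le card_mono finite_imageI le_trans)
  also have "\<dots> \<le> (\<Sum>v\<in>?C. card (A `` {v}))" using finite_V by (intro card_UN_le) auto
  finally have "real (card (qarcs g `` {c})) \<le> (\<Sum>v\<in>?C. real (card (A `` {v})))"
    by (simp only: of_nat_le_iff flip: of_nat_sum)
  also have "\<dots> \<le> (\<Sum>v\<in>?C. \<Delta>)" using assms by (intro sum_mono) auto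
  finally show ?thesis by simp
qed

text \<open>\<open>W\<close> is the union of the closed neighbourhood of the class \<open>c\<close>,
  and every mate in \<open>M\<close> has \<open>m\<close> neighbours inside it. With
  \<open>m\<close> mates this gives the dense subgraph of outcome (i).\<close>

lemma dense_around_class:
  assumes size: "\<And>w. card {v \<in> V. g v = w} \<le> T"
    and M: "M \<subseteq> qarcs g `` {c}"
    and single: "\<And>y v. y \<in> M \<Longrightarrow> v \<in> V \<Longrightarrow> g v = y \<longleftrightarrow> v = y"
    and mates: "\<And>y. y \<in> M \<Longrightarrow> m \<le> real (card (qarcs g `` {y} \<inter> insert c (qarcs g `` {c})))"
  defines "W \<equiv> {v \<in> V. g v \<in> insert c (qarcs g `` {c})}"
  shows "card W \<le> T * (1 + card (qarcs g `` {c}))"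
    and "real (card M) * m \<le> real (card (A \<inter> W \<times> W))"
proof -
  let ?I = "insert c (qarcs g `` {c})"
  have finI: "finite ?I" using finite_qnbrs by blast
  have "W = (\<Union>w\<in>?I. {v \<in> V. g v = w})" by (auto simp: W_def)
  then have "card W \<le> (\<Sum>w\<in>?I. card {v \<in> V. g v = w})" using card_UN_le[OF finI] by simp
  also have "\<dots> \<le> (\<Sum>w\<in>?I. T)" using size by (intro sum_mono) auto
  also have "\<dots> = T * card ?I" by simp
  also have "card ?I \<le> 1 + card (qarcs g `` {c})" by (simp add: card_insert_if finite_qnbrs)
  finally show "card W \<le> T * (1 + card (qarcs g `` {c}))" by simp
  have finM: "finite M" using M finite_qnbrs by (rule finite_subset)
  have MW: "y \<in> W" if "y \<in> M" for y
  proof -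
    have "(c, y) \<in> qarcs g" using M that by auto
    then obtain v where v: "v \<in> V" "g v = y" unfolding qarcs_def using arcD(2) by blast
    then have "v = y" using single[OF that] by blast
    then show ?thesis using v M that by (auto simp: W_def)
  qed
  have each: "m \<le> real (card ((A \<inter> W \<times> W) `` {y}))" if y: "y \<in> M" for y
  proof -
    \<comment> \<open>As \<open>y\<close> is a singleton class, each quotient arc at
      \<open>y\<close> lifts to an arc of the graph at \<open>y\<close> itself, and different labels
      lift to different neighbours.\<close>
    have "qarcs g `` {y} \<inter> ?I \<subseteq> g ` ((A \<inter> W \<times> W) `` {y})"
    proof
      fix w assume w: "w \<in> qarcs g `` {y} \<inter> ?I"
      then obtain u v where uv: "(u, v) \<in> A" "g u = y" "g v = w" by (auto simp: qarcs_def)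
      then have "u = y" using single[OF y] arcD by blast
      moreover have "v \<in> W" using uv w arcD by (auto simp: W_def)
      ultimately show "w \<in> g ` ((A \<inter> W \<times> W) `` {y})" using uv MW[OF y] by auto
    qed
    moreover have "finite ((A \<inter> W \<times> W) `` {y})" using finite_A by auto
    ultimately have "card (qarcs g `` {y} \<inter> ?I) \<le> card ((A \<inter> W \<times> W) `` {y})"
      by (meson card_image_le card_mono finite_imageI le_trans)
    then show ?thesis using mates[OF y] by linarith
  qed
  have "real (card M) * m \<le> (\<Sum>y\<in>M. real (card ((A \<inter> W \<times> W) `` {y})))"
    using each sum_mono[of M "\<lambda>_. m"] by simp
  also have "\<dots> = real (card (SIGMA y : M. (A \<inter> W \<times> W) `` {y}))"
    using finM finite_A by (subst card_SigmaI) auto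
  also have "\<dots> \<le> real (card (A \<inter> W \<times> W))"
    using finite_A by (intro of_nat_mono card_mono) auto
  finally show "real (card M) * m \<le> real (card (A \<inter> W \<times> W))" .
qed

end

text \<open>S is the set of vertices of small degree and m the threshold for being mates; few_mates is
  what the absence of a small dense subgraph provides.\<close>

locale sparse_arcs = simple_arcs V A for V :: "'a set" and A +
  fixes S :: "'a set" and T :: nat and m :: real
  assumes S_subset: "S \<subseteq> V" and T_pos: "0 < T" and m_pos: "0 < m"
    and few_mates: "\<And>(g :: 'a \<Rightarrow> 'a) c. (\<And>w. card {v \<in> V. g v = w} \<le> T) \<Longrightarrow>
      {v \<in> V. g v = c} \<subseteq> S \<Longrightarrow> card {v \<in> V. g v = c} < T \<Longrightarrow>
      real (card {y \<in> qarcs g `` {c}. (\<forall>v\<in>V. g v = y \<longleftrightarrow> v = y) \<and>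
        m \<le> real (card (qarcs g `` {y} \<inter> insert c (qarcs g `` {c})))}) < m"
begin

definition class_of :: "('a \<Rightarrow> 'a) \<Rightarrow> 'a \<Rightarrow> 'a set" where
  "class_of g w = {v \<in> V. g v = w}"

lemma finite_class: "finite (class_of g w)"
  using finite_V by (simp add: class_of_def)

text \<open>A state of a depth-first search: U unvisited, D abandoned, xs the stack (top first), P the
  stacks of the completed searches. The labelling g contracts each search tree, including its
  abandoned vertices, and the arcs F pay for the arcs between abandoned vertices of different
  trees.\<close>

definition dfs_inv ::
  "('a \<Rightarrow> 'a) \<Rightarrow> 'a set \<Rightarrow> 'a set \<Rightarrow> 'a list \<Rightarrow> 'a list set \<Rightarrow> 'a rel \<Rightarrow> bool" where
  "dfs_inv g U D xs P F \<longleftrightarrow>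
     U \<union> D \<union> set xs \<union> \<Union>(set ` P) = S \<and> U \<inter> D = {} \<and> (U \<union> D) \<inter> set xs = {} \<and>
     (U \<union> D \<union> set xs) \<inter> \<Union>(set ` P) = {} \<and> disjoint_family_on set P \<and> finite P \<and> [] \<notin> P \<and>
     (\<forall>p\<in>insert xs P. successively (\<lambda>u v. (u, v) \<in> A) p \<and> distinct p \<and>
        (\<exists>w. \<forall>v\<in>set p. g v = w)) \<and>
     (\<forall>x\<in>U \<union> (V - S). \<forall>v\<in>V. g v = x \<longleftrightarrow> v = x) \<and>
     (\<forall>w. card (class_of g w) \<le> T) \<and>
     T * card P + (case xs of [] \<Rightarrow> 0 | x # _ \<Rightarrow> card (class_of g (g x))) \<le> card (S - U) \<and>
     real (card A) \<le> real (card (qarcs g)) + 2 * m * real (card (S - U)) \<and>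
     F \<subseteq> A \<and> real (card F) \<le> m * real (card D) \<and>
     (\<forall>x\<in>D. \<forall>y\<in>D \<union> U \<union> set xs. (x, y) \<in> A \<longrightarrow> g x \<noteq> g y \<longrightarrow> (x, y) \<in> F \<or> (y, x) \<in> F)"

lemma
  assumes "dfs_inv g U D xs P F"
  shows dfs_cover: "U \<union> D \<union> set xs \<union> \<Union>(set ` P) = S"
    and dfs_disj_UD: "U \<inter> D = {}"
    and dfs_disj_stack: "(U \<union> D) \<inter> set xs = {}"
    and dfs_disj_paths: "(U \<union> D \<union> set xs) \<inter> \<Union>(set ` P) = {}"
    and dfs_disjoint: "disjoint_family_on set P"
    and dfs_finite: "finite P"
    and dfs_nonempty: "[] \<notin> P"
    and dfs_paths: "\<forall>p\<in>insert xs P. successively (\<lambda>u v. (u, v) \<in> A) p \<and> distinct p \<and>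
      (\<exists>w. \<forall>v\<in>set p. g v = w)"
    and dfs_single: "\<forall>x\<in>U \<union> (V - S). \<forall>v\<in>V. g v = x \<longleftrightarrow> v = x"
    and dfs_class: "\<forall>w. card (class_of g w) \<le> T"
    and dfs_count: "T * card P + (case xs of [] \<Rightarrow> 0 | x # _ \<Rightarrow> card (class_of g (g x))) \<le> card (S - U)"
    and dfs_loss: "real (card A) \<le> real (card (qarcs g)) + 2 * m * real (card (S - U))"
    and dfs_paid_arcs: "F \<subseteq> A"
    and dfs_card_paid: "real (card F) \<le> m * real (card D)"
    and dfs_paid: "\<forall>x\<in>D. \<forall>y\<in>D \<union> U \<union> set xs.
      (x, y) \<in> A \<longrightarrow> g x \<noteq> g y \<longrightarrow> (x, y) \<in> F \<or> (y, x) \<in> F"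
  using assms unfolding dfs_inv_def by - (elim conjE, assumption)+

lemmas dfs_sets = dfs_cover dfs_disj_UD dfs_disj_stack dfs_disj_paths

lemma finite_S: "finite S"
  using S_subset finite_V by (rule finite_subset)

section \<open>Steps of the search and its termination\<close>

lemma dfs_start: "dfs_inv id S {} [] {} {}"
proof -
  have "class_of id w \<subseteq> {w}" for w by (auto simp: class_of_def)
  then have "card (class_of id w) \<le> card {w}" for w by (rule card_mono[rotated]) simp
  then have 1: "card (class_of id w) \<le> T" for w
    using T_pos by (metis One_nat_def Suc_leI card.empty card.insert empty_iff finite.emptyI order_trans)
  have "qarcs id = A" using arc_neq by (auto simp: qarcs_def)
  then show ?thesis using 1 by (auto simp: dfs_inv_def disjoint_family_on_def)
qed

lemma card_diff_remove:
  assumes "y \<in> U" and "U \<subseteq> S"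
  shows "card (S - (U - {y})) = card (S - U) + 1"
proof -
  have "S - (U - {y}) = insert y (S - U)" using assms by auto
  then show ?thesis using assms finite_S by simp
qed

text \<open>A new tree starts as a one-vertex class; the newly visited vertex pays for it in the
  bound on \<open>T * card P\<close>.\<close>

lemma dfs_step_new:
  assumes inv: "dfs_inv g U D [] P F" and y: "y \<in> U"
  shows "dfs_inv g (U - {y}) D [y] P F"
proof -
  have US: "U \<subseteq> S" using dfs_sets[OF inv] by auto
  then have yV: "y \<in> V" using S_subset y by auto
  have single: "\<forall>v\<in>V. g v = y \<longleftrightarrow> v = y" using dfs_single[OF inv] y by auto
  then have gy: "g y = y" using yV by blast
  have "class_of g (g y) = {y}" unfolding class_of_def gy using single yV by blast
  then have 1: "T * card P + card (class_of g (g y)) \<le> card (S - (U - {y}))"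
    using dfs_count[OF inv] card_diff_remove[OF y US] by simp
  have 2: "real (card A) \<le> real (card (qarcs g)) + 2 * m * real (card (S - (U - {y})))"
    using dfs_loss[OF inv] card_diff_remove[OF y US] m_pos by (simp add: algebra_simps)
  show ?thesis
    unfolding dfs_inv_def
  proof (intro conjI)
    show "U - {y} \<union> D \<union> set [y] \<union> \<Union> (set ` P) = S" using dfs_sets[OF inv] y by auto
    show "(U - {y} \<union> D \<union> set [y]) \<inter> \<Union> (set ` P) = {}" using dfs_sets[OF inv] y by auto
    show "(U - {y} \<union> D) \<inter> set [y] = {}" using dfs_sets[OF inv] y by auto
    show "\<forall>x\<in>D. \<forall>z\<in>D \<union> (U - {y}) \<union> set [y]. (x, z) \<in> A \<longrightarrow> g x \<noteq> g z \<longrightarrow> (x, z) \<in> F \<or> (z, x) \<in> F"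
      using dfs_paid[OF inv] y by auto
    show "\<forall>p\<in>insert [y] P. successively (\<lambda>u v. (u, v) \<in> A) p \<and> distinct p \<and>
        (\<exists>w. \<forall>v\<in>set p. g v = w)" using dfs_paths[OF inv] by simp
    show "\<forall>x\<in>U - {y} \<union> (V - S). \<forall>v\<in>V. g v = x \<longleftrightarrow> v = x" using dfs_single[OF inv] by blast
    show "(U - {y}) \<inter> D = {}" using dfs_disj_UD[OF inv] by blast
    show "T * card P + (case [y] of [] \<Rightarrow> 0 | x # _ \<Rightarrow> card (class_of g (g x))) \<le> card (S - (U - {y}))"
      using 1 by simp
  qed (rule 2 dfs_disjoint[OF inv] dfs_finite[OF inv] dfs_nonempty[OF inv] dfs_class[OF inv]
    dfs_paid_arcs[OF inv] dfs_card_paid[OF inv])+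
qed

text \<open>A class of full size \<open>T\<close> pays for one more completed path. Only the stack
  becomes the path; vertices of the tree abandoned earlier stay in \<open>D\<close>.\<close>

lemma dfs_step_complete:
  assumes inv: "dfs_inv g U D (x # xs) P F" and full: "card (class_of g (g x)) = T"
  shows "dfs_inv g U D [] (insert (x # xs) P) F"
proof -
  have new: "x # xs \<notin> P" using dfs_disj_paths[OF inv] by auto
  have disj: "disjoint_family_on set (insert (x # xs) P)"
    using dfs_disjoint[OF inv] dfs_disj_paths[OF inv] unfolding disjoint_family_on_def by auto
  have finP: "finite P" using dfs_finite[OF inv] .
  have 1: "T * card (insert (x # xs) P) \<le> card (S - U)"
    using dfs_count[OF inv] full new finP by simp
  show ?thesis
    unfolding dfs_inv_def
  proof (intro conjI)
    show "U \<union> D \<union> set [] \<union> \<Union> (set ` insert (x # xs) P) = S"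
      using dfs_sets[OF inv] by auto
    show "(U \<union> D \<union> set []) \<inter> \<Union> (set ` insert (x # xs) P) = {}"
      using dfs_sets[OF inv] by auto
    show "\<forall>p\<in>insert [] (insert (x # xs) P). successively (\<lambda>u v. (u, v) \<in> A) p \<and> distinct p \<and>
        (\<exists>w. \<forall>v\<in>set p. g v = w)"
      using dfs_paths[OF inv] by simp
    show "finite (insert (x # xs) P)" using finP by simp
    show "[] \<notin> insert (x # xs) P" using dfs_nonempty[OF inv] by simp
    show "(U \<union> D) \<inter> set [] = {}" by simp
    show "T * card (insert (x # xs) P) +
        (case [] of [] \<Rightarrow> 0 | x # _ \<Rightarrow> card (class_of g (g x))) \<le> card (S - U)"
      using 1 by simp
    show "\<forall>x\<in>D. \<forall>y\<in>D \<union> U \<union> set []. (x, y) \<in> A \<longrightarrow> g x \<noteq> g y \<longrightarrow> (x, y) \<in> F \<or> (y, x) \<in> F"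
      using dfs_paid[OF inv] by auto
  qed (rule disj dfs_disj_UD[OF inv] dfs_single[OF inv] dfs_class[OF inv] dfs_loss[OF inv]
    dfs_paid_arcs[OF inv] dfs_card_paid[OF inv])+
qed

text \<open>Merging the non-mate \<open>y\<close> into the tree loses at most \<open>2 * m\<close>
  arcs, charged to \<open>y\<close>, which leaves \<open>U\<close>. As \<open>y\<close> is adjacent
  to the top, the stack stays a path.\<close>

lemma dfs_step_push:
  assumes inv: "dfs_inv g U D (x # xs) P F" and notfull: "card (class_of g (g x)) < T"
    and y: "y \<in> U" "(x, y) \<in> A"
    and nomate: "real (card (qarcs g `` {y} \<inter> insert (g x) (qarcs g `` {g x}))) < m"
  shows "dfs_inv (g(y := g x)) (U - {y}) D (y # x # xs) P F"
proof -
  define c where "c = g x"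
  define g' where "g' = g(y := c)"
  have US: "U \<subseteq> S" and xS: "x \<in> S" and xU: "x \<notin> U" and yS: "y \<in> S"
    and y_notin: "y \<notin> D" "y \<notin> set (x # xs)" "y \<notin> \<Union> (set ` P)"
    using dfs_sets[OF inv] y by auto
  have xV: "x \<in> V" and yV: "y \<in> V" using xS yS S_subset by auto
  have single: "g v = z \<longleftrightarrow> v = z" if "z \<in> U \<union> (V - S)" "v \<in> V" for z v
    using dfs_single[OF inv] that by blast
  have c_neq: "c \<noteq> z" if "z \<in> U \<union> (V - S)" for z
    using single[OF that xV] that xS xU by (auto simp: c_def)
  have classes: "class_of g' w \<subseteq> (if w = c then insert y (class_of g c) else class_of g w)" for w
    by (auto simp: class_of_def g'_def)
  have yc: "y \<notin> class_of g c" using single[of y y] c_neq[of y] y yV by (auto simp: class_of_def)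
  have class_c: "class_of g' c = insert y (class_of g c)"
    using yV by (auto simp: class_of_def g'_def)
  have card_c: "card (class_of g' c) = card (class_of g c) + 1"
    using yc finite_class by (simp add: class_c)
  have card_le: "card (class_of g' w) \<le> T" for w
  proof (cases "w = c")
    case True
    then show ?thesis using card_c notfull by (simp add: c_def)
  next
    case False
    then have "class_of g' w \<subseteq> class_of g w" using classes[of w] by simp
    then have "card (class_of g' w) \<le> card (class_of g w)" by (rule card_mono[OF finite_class])
    also have "\<dots> \<le> T" using dfs_class[OF inv] by blast
    finally show ?thesis .
  qed
  have old: "g' v = g v" if "v \<noteq> y" for v using that by (simp add: g'_def)
  have loss: "card (qarcs g) \<le> card (qarcs g') + 2 * card (qarcs g `` {y} \<inter> insert c (qarcs g `` {c}))"
    unfolding g'_def using single c_neq y by (intro card_qarcs_merge) auto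
  have arcs: "real (card A) \<le> real (card (qarcs g')) + 2 * m * real (card (S - (U - {y})))"
  proof -
    have "real (card A) \<le> real (card (qarcs g)) + 2 * m * real (card (S - U))"
      by (rule dfs_loss[OF inv])
    also have "real (card (qarcs g)) \<le> real (card (qarcs g')) + 2 * m"
      using loss nomate by (simp add: c_def)
    finally show ?thesis using card_diff_remove[OF y(1) US] by (simp add: algebra_simps)
  qed
  have "dfs_inv g' (U - {y}) D (y # x # xs) P F"
    unfolding dfs_inv_def
  proof (intro conjI)
    show "U - {y} \<union> D \<union> set (y # x # xs) \<union> \<Union> (set ` P) = S"
      using dfs_sets[OF inv] y by auto
    show "(U - {y} \<union> D) \<inter> set (y # x # xs) = {}" using dfs_sets[OF inv] y_notin by auto
    show "(U - {y} \<union> D \<union> set (y # x # xs)) \<inter> \<Union> (set ` P) = {}"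
      using dfs_sets[OF inv] y_notin by auto
    show "\<forall>p\<in>insert (y # x # xs) P. successively (\<lambda>u v. (u, v) \<in> A) p \<and> distinct p \<and>
        (\<exists>w. \<forall>v\<in>set p. g' v = w)"
    proof
      fix p assume p: "p \<in> insert (y # x # xs) P"
      have old_inv: "successively (\<lambda>u v. (u, v) \<in> A) q \<and> distinct q \<and>
        (\<exists>w. \<forall>v\<in>set q. g v = w)" if "q \<in> insert (x # xs) P" for q
        using dfs_paths[OF inv] that by blast
      show "successively (\<lambda>u v. (u, v) \<in> A) p \<and> distinct p \<and>
        (\<exists>w. \<forall>v\<in>set p. g' v = w)"
      proof (cases "p \<in> P")
        case True
        then have "y \<notin> set p" using y_notin by auto
        then have "\<forall>u\<in>set p. g' u = g u" using old by metis
        then show ?thesis using old_inv[of p] True by simp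
      next
        case False
        then have p: "p = y # x # xs" using p by auto
        have "\<forall>u\<in>set (x # xs). g u = c" using old_inv[of "x # xs"] by (auto simp: c_def)
        then have "\<forall>u\<in>set p. g' u = c" by (simp add: p g'_def)
        then show ?thesis using old_inv[of "x # xs"] p y arc_sym y_notin by auto
      qed
    qed
    show "\<forall>z\<in>U - {y} \<union> (V - S). \<forall>v\<in>V. g' v = z \<longleftrightarrow> v = z"
      using single c_neq yS by (auto simp: g'_def)
    show "T * card P + (case y # x # xs of [] \<Rightarrow> 0 | x # _ \<Rightarrow> card (class_of g' (g' x)))
        \<le> card (S - (U - {y}))"
    proof -
      have "g' y = c" by (simp add: g'_def)
      moreover have "T * card P + card (class_of g c) \<le> card (S - U)"
        using dfs_count[OF inv] by (simp add: c_def)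
      ultimately show ?thesis using card_c card_diff_remove[OF y(1) US] by simp
    qed
    show "\<forall>u\<in>D. \<forall>w\<in>D \<union> (U - {y}) \<union> set (y # x # xs).
        (u, w) \<in> A \<longrightarrow> g' u \<noteq> g' w \<longrightarrow> (u, w) \<in> F \<or> (w, u) \<in> F"
    proof (intro ballI impI)
      fix u w assume uw: "u \<in> D" "w \<in> D \<union> (U - {y}) \<union> set (y # x # xs)" "(u, w) \<in> A" "g' u \<noteq> g' w"
      have "u \<noteq> y" using uw y_notin by auto
      \<comment> \<open>No new debt arises: if \<open>w\<close> is the pushed vertex, it was an
        unvisited singleton, so its arcs to \<open>D\<close> were already paid for.\<close>
      have "g u \<noteq> g w"
      proof (cases "w = y")
        case True
        then show ?thesis using single[of y u] single[of y y] y yV \<open>u \<noteq> y\<close> arcD[OF uw(3)] by auto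
      next
        case False
        then show ?thesis using uw(4) old \<open>u \<noteq> y\<close> by simp
      qed
      moreover have "w \<in> D \<union> U \<union> set (x # xs)" using uw(2) y by auto
      ultimately show "(u, w) \<in> F \<or> (w, u) \<in> F"
        using dfs_paid[OF inv] uw by blast
    qed
    show "(U - {y}) \<inter> D = {}" using dfs_disj_UD[OF inv] by blast
    show "\<forall>w. card (class_of g' w) \<le> T" using card_le by blast
  qed (rule arcs dfs_disjoint[OF inv] dfs_finite[OF inv] dfs_nonempty[OF inv]
    dfs_paid_arcs[OF inv] dfs_card_paid[OF inv])+
  then show ?thesis by (simp add: g'_def c_def)
qed

text \<open>When no push is possible, all unvisited neighbours of \<open>x\<close> are mates of its
  class, so there are fewer than \<open>m\<close> of them. Adding the arcs to them to
  \<open>F\<close> is the price of abandoning \<open>x\<close>.\<close>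

lemma dfs_step_pop:
  assumes inv: "dfs_inv g U D (x # xs) P F" and notfull: "card (class_of g (g x)) < T"
    and mates: "\<And>y. y \<in> U \<Longrightarrow> (x, y) \<in> A \<Longrightarrow>
      m \<le> real (card (qarcs g `` {y} \<inter> insert (g x) (qarcs g `` {g x})))"
  shows "dfs_inv g U (insert x D) xs P (F \<union> {x} \<times> (U \<inter> A `` {x}))"
proof -
  define c where "c = g x"
  have US: "U \<subseteq> S" and xS: "x \<in> S" and x_notin: "x \<notin> U" "x \<notin> D" "x \<notin> set xs" "x \<notin> \<Union> (set ` P)"
    using dfs_sets[OF inv] dfs_paths[OF inv] by auto
  have xV: "x \<in> V" using xS S_subset by auto
  have single: "g v = z \<longleftrightarrow> v = z" if "z \<in> U \<union> (V - S)" "v \<in> V" for z v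
    using dfs_single[OF inv] that by blast
  \<comment> \<open>A vertex outside \<open>S\<close> forms a class of its own, whereas this class
    contains \<open>x\<close>.\<close>
  have "class_of g c \<subseteq> S"
  proof
    fix v assume v: "v \<in> class_of g c"
    show "v \<in> S"
    proof (rule ccontr)
      assume "v \<notin> S"
      then have "v \<in> U \<union> (V - S)" "g v = g x" using v by (auto simp: class_of_def c_def)
      then have "x = v" using single[of v v] single[of v x] v xV by (auto simp: class_of_def)
      then show False using xS \<open>v \<notin> S\<close> by simp
    qed
  qed
  then have few: "real (card {y \<in> qarcs g `` {c}. (\<forall>v\<in>V. g v = y \<longleftrightarrow> v = y) \<and>
        m \<le> real (card (qarcs g `` {y} \<inter> insert c (qarcs g `` {c})))}) < m" (is "real (card ?M) < m")
    using dfs_class[OF inv] notfull by (intro few_mates) (auto simp: class_of_def c_def)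
  have "U \<inter> A `` {x} \<subseteq> ?M"
  proof
    fix y assume y: "y \<in> U \<inter> A `` {x}"
    have "y \<in> V" using y arcD by auto
    then have gy: "g y = y" using single[of y y] y by auto
    have "g x \<noteq> y" using single[of y x] y xV x_notin by auto
    then have "(c, y) \<in> qarcs g" unfolding qarcs_def c_def using y gy by force
    then show "y \<in> ?M" using mates[of y] y single by (auto simp: c_def)
  qed
  then have "card (U \<inter> A `` {x}) \<le> card ?M"
    by (intro card_mono finite_subset[OF _ finite_qnbrs[of g "{c}"]]) auto
  then have few: "real (card (U \<inter> A `` {x})) \<le> m" using few by linarith
  have finD: "finite D"
    using dfs_cover[OF inv] finite_S by (auto intro: finite_subset)
  have cardF: "real (card (F \<union> {x} \<times> (U \<inter> A `` {x}))) \<le> m * real (card (insert x D))"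
  proof -
    have "card (F \<union> {x} \<times> (U \<inter> A `` {x})) \<le> card F + card (U \<inter> A `` {x})"
      using card_Un_le[of F "{x} \<times> (U \<inter> A `` {x})"] by (simp add: card_cartesian_product)
    moreover have "real (card F) \<le> m * real (card D)" by (rule dfs_card_paid[OF inv])
    ultimately show ?thesis using few x_notin finD by (simp add: algebra_simps)
  qed
  have same: "g w = c" if "w \<in> set xs" for w using dfs_paths[OF inv] that by (auto simp: c_def)
  have sizes: "T * card P + card (class_of g c) \<le> card (S - U)"
    using dfs_count[OF inv] by (simp add: c_def)
  show ?thesis
    unfolding dfs_inv_def
  proof (intro conjI)
    show "U \<union> insert x D \<union> set xs \<union> \<Union> (set ` P) = S" using dfs_sets[OF inv] by auto
    show "U \<inter> insert x D = {}" using dfs_sets[OF inv] x_notin by auto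
    show "(U \<union> insert x D) \<inter> set xs = {}" using dfs_sets[OF inv] x_notin by auto
    show "(U \<union> insert x D \<union> set xs) \<inter> \<Union> (set ` P) = {}" using dfs_sets[OF inv] x_notin by auto
    show "\<forall>p\<in>insert xs P. successively (\<lambda>u v. (u, v) \<in> A) p \<and> distinct p \<and>
        (\<exists>w. \<forall>v\<in>set p. g v = w)"
    proof -
      have "successively (\<lambda>u v. (u, v) \<in> A) xs \<and> distinct xs"
        using dfs_paths[OF inv] by (auto simp: successively_Cons)
      then show ?thesis using dfs_paths[OF inv] same by auto
    qed
    \<comment> \<open>The next vertex on the stack carries the same label. If the stack runs empty,
      the unfinished class simply drops out of the count.\<close>
    show "T * card P + (case xs of [] \<Rightarrow> 0 | x # _ \<Rightarrow> card (class_of g (g x))) \<le> card (S - U)"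
      using sizes same by (cases xs) auto
    show "F \<union> {x} \<times> (U \<inter> A `` {x}) \<subseteq> A" using dfs_paid_arcs[OF inv] by auto
    show "\<forall>u\<in>insert x D. \<forall>w\<in>insert x D \<union> U \<union> set xs. (u, w) \<in> A \<longrightarrow> g u \<noteq> g w \<longrightarrow>
        (u, w) \<in> F \<union> {x} \<times> (U \<inter> A `` {x}) \<or> (w, u) \<in> F \<union> {x} \<times> (U \<inter> A `` {x})"
    proof (intro ballI impI)
      fix u w assume uw: "u \<in> insert x D" "w \<in> insert x D \<union> U \<union> set xs" "(u, w) \<in> A" "g u \<noteq> g w"
      have old: "(a, b) \<in> F \<or> (b, a) \<in> F"
        if "a \<in> D" "b \<in> D \<union> U \<union> set (x # xs)" "(a, b) \<in> A" "g a \<noteq> g b" for a b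
        using dfs_paid[OF inv] that by blast
      show "(u, w) \<in> F \<union> {x} \<times> (U \<inter> A `` {x}) \<or> (w, u) \<in> F \<union> {x} \<times> (U \<inter> A `` {x})"
      proof (cases "u = x")
        case True
        \<comment> \<open>Stack vertices share the label of \<open>x\<close>. Arcs to
          \<open>D\<close> were paid for from the other end while \<open>x\<close> was on the stack,
          and arcs to \<open>U\<close> are paid for now.\<close>
        then have "w \<notin> set xs" "w \<noteq> x" using uw(4) same by (auto simp: c_def)
        then consider "w \<in> D" | "w \<in> U" using uw(2) by auto
        then show ?thesis
        proof cases
          case 1
          then show ?thesis using old[of w x] True uw arc_sym by auto
        next
          case 2
          then show ?thesis using True uw by auto
        qed
      next
        case False
        then show ?thesis using old[of u w] uw by auto
      qed
    qed
  qed (rule cardF dfs_disjoint[OF inv] dfs_finite[OF inv] dfs_nonempty[OF inv]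
    dfs_single[OF inv] dfs_class[OF inv] dfs_loss[OF inv])+
qed

lemma dfs_finished: "\<exists>g D P F. dfs_inv g {} D [] P F"
proof -
  have "dfs_inv g U D xs P F \<Longrightarrow> \<exists>g D P F. dfs_inv g {} D [] P F" for g U D xs P F
  \<comment> \<open>The weight 2 makes the measure drop when a vertex moves from \<open>U\<close> to
    the stack.\<close>
  proof (induction "2 * card U + length xs" arbitrary: g U D xs P F rule: less_induct)
    case less
    have "finite U" using dfs_cover[OF less.prems] finite_S by (auto intro: finite_subset)
    then have small: "2 * card (U - {y}) + Suc n < 2 * card U + n" if "y \<in> U" for y n
      using card_Diff1_less[OF \<open>finite U\<close> that] by linarith
    show ?case
    proof (cases xs)
      case Nil
      show ?thesis
      proof (cases "U = {}")
        case True
        then show ?thesis using less.prems Nil by blast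
      next
        case False
        then obtain y where y: "y \<in> U" by auto
        show ?thesis
          using less.hyps[OF _ dfs_step_new[OF _ y]] less.prems Nil small[OF y, of 0] by auto
      qed
    next
      case (Cons x ys)
      have inv: "dfs_inv g U D (x # ys) P F" using less.prems Cons by simp
      have le: "card (class_of g (g x)) \<le> T" using dfs_class[OF inv] by blast
      show ?thesis
      proof (cases "card (class_of g (g x)) = T")
        case True
        show ?thesis using less.hyps[OF _ dfs_step_complete[OF inv True]] Cons by simp
      next
        case False
        then have lt: "card (class_of g (g x)) < T" using le by simp
        show ?thesis
        proof (cases "\<exists>y. y \<in> U \<and> (x, y) \<in> A \<and>
            real (card (qarcs g `` {y} \<inter> insert (g x) (qarcs g `` {g x}))) < m")
          case True
          then obtain y where y: "y \<in> U" "(x, y) \<in> A"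
            "real (card (qarcs g `` {y} \<inter> insert (g x) (qarcs g `` {g x}))) < m" by blast
          show ?thesis
            using less.hyps[OF _ dfs_step_push[OF inv lt y]] Cons small[OF y(1), of "Suc (length ys)"]
            by simp
        next
          case False
          then have "m \<le> real (card (qarcs g `` {y} \<inter> insert (g x) (qarcs g `` {g x})))"
            if "y \<in> U" "(x, y) \<in> A" for y using that by force
          from less.hyps[OF _ dfs_step_pop[OF inv lt this]] show ?thesis using Cons by simp
        qed
      qed
    qed
  qed
  then show ?thesis using dfs_start by blast
qed

end

section \<open>Minors from paths and from stars\<close>

lemma successively_tree_set:
  assumes "successively (\<lambda>u v. (u, v) \<in> A) p" and "p \<noteq> []"
  shows "set p \<in> tree_sets A"
  using assms
proof (induction p rule: rev_induct)
  case Nil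
  then show ?case by simp
next
  case (snoc y p)
  show ?case
  proof (cases "p = []")
    case True
    then show ?thesis by (simp add: tree_sets.singleton)
  next
    case False
    then have "set p \<in> tree_sets A" "(last p, y) \<in> A"
      using snoc by (auto simp: successively_append_iff)
    then have "insert y (set p) \<in> tree_sets A"
      using False by (intro tree_sets.insert[of _ _ "last p"]) auto
    then show ?thesis by simp
  qed
qed

text \<open>Cut off blocks of \<open>s\<close> consecutive vertices. Only the last one can be
  shorter, which costs the extra \<open>s - 1\<close>.\<close>

lemma path_chunks:
  assumes "successively (\<lambda>u v. (u, v) \<in> A) p" and "distinct p" and "0 < s"
  shows "\<exists>\<C>. finite \<C> \<and> \<Union>\<C> = set p \<and> disjoint \<C> \<and> \<C> \<subseteq> tree_sets A \<and>
    (\<forall>C\<in>\<C>. card C \<le> s) \<and> s * card \<C> \<le> length p + (s - 1)"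
  using assms(1,2)
proof (induction "length p" arbitrary: p rule: less_induct)
  case less
  show ?case
  proof (cases "p = []")
    case True
    then show ?thesis by (intro exI[of _ "{}"]) auto
  next
    case False
    define t where "t = take s p"
    define q where "q = drop s p"
    define C where "C = set t"
    have pq: "p = t @ q" by (simp add: t_def q_def)
    have succ: "successively (\<lambda>u v. (u, v) \<in> A) t" "successively (\<lambda>u v. (u, v) \<in> A) q"
      using less.prems(1) by (simp_all add: pq successively_append_iff)
    have dist: "distinct q" "C \<inter> set q = {}" "set p = C \<union> set q"
      using less.prems(2) by (simp_all add: pq C_def)
    have "length q < length p" using False assms(3) by (simp add: q_def)
    then obtain \<C> where C: "finite \<C>" "\<Union>\<C> = set q" "disjoint \<C>" "\<C> \<subseteq> tree_sets A"
      "\<forall>C\<in>\<C>. card C \<le> s" "s * card \<C> \<le> length q + (s - 1)"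
      using less.hyps[OF _ succ(2) dist(1)] by blast
    have nonempty: "t \<noteq> []" using False assms(3) by (simp add: t_def)
    have CT: "C \<in> tree_sets A" unfolding C_def by (rule successively_tree_set[OF succ(1) nonempty])
    have cardC: "card C \<le> s" unfolding C_def using card_length[of t] by (simp add: t_def)
    have disj: "disjoint (insert C \<C>)" using C(2,3) dist(2) by (auto simp: pairwise_insert disjnt_def)
    have count: "s * card (insert C \<C>) \<le> length p + (s - 1)"
    proof (cases "q = []")
      \<comment> \<open>The last block is non-empty, so \<open>s\<close> is at most its length plus
        \<open>s - 1\<close>.\<close>
      case True
      then have "\<C> \<subseteq> {{}}" using C(2) by auto
      moreover have "{} \<notin> \<C>" using C(4) tree_sets_nonempty by blast
      ultimately have "\<C> = {}" by blast
      moreover have "1 \<le> length p" using False by (cases p) auto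
      ultimately show ?thesis using assms(3) by simp
    next
      case False
      then have "length p = s + length q" by (auto simp: q_def)
      moreover have "card (insert C \<C>) \<le> Suc (card \<C>)" by (simp add: C(1) card_insert_if)
      then have "s * card (insert C \<C>) \<le> s * Suc (card \<C>)" by (rule mult_le_mono2)
      ultimately show ?thesis using C(6) by simp
    qed
    show ?thesis
      using C CT cardC disj count dist(3) by (intro exI[of _ "insert C \<C>"]) auto
  qed
qed

context simple_arcs
begin

text \<open>The parts refine the classes of \<open>g\<close>, so contracting them keeps at least as
  many arcs as contracting the classes.\<close>

lemma quotient_minor:
  assumes "pair_graph G" and "V \<subseteq> pverts G" and "A \<subseteq> parcs G"
    and "finite \<C>" and cover: "\<Union>\<C> = V" and disj: "disjoint \<C>" and tree: "\<C> \<subseteq> tree_sets A"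
    and size: "\<And>C. C \<in> \<C> \<Longrightarrow> card C \<le> s"
    and const: "\<And>C. C \<in> \<C> \<Longrightarrow> \<exists>w. \<forall>v\<in>C. g v = w"
  shows "\<exists>G' :: 'a pair_pre_digraph. pair_graph G' \<and> bounded_minor s G' G \<and>
    real (card (qarcs g)) / (2 * real (card \<C>)) \<le> density G'"
proof -
  define R where "R = {(C, C'). C \<in> \<C> \<and> C' \<in> \<C> \<and> C \<noteq> C' \<and> (\<exists>u\<in>C. \<exists>v\<in>C'. (u, v) \<in> A)}"
  have RV: "R \<subseteq> \<C> \<times> \<C>" by (auto simp: R_def)
  have "simple_arcs \<C> R"
  proof
    show "sym R" using arc_sym by (fastforce simp: R_def sym_def)
  qed (auto simp: R_def irrefl_def assms(4))
  moreover have "disjoint_family_on (\<lambda>C. C) \<C>"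
    using disj by (auto simp: disjoint_family_on_def pairwise_def disjnt_def)
  ultimately obtain G' :: "'a pair_pre_digraph" where G': "pair_graph G'" "bounded_minor s G' G"
    "density G' = real (card R) / (2 * real (card \<C>))"
    using bounded_minor_of_family[of A G \<C> R "\<lambda>C. C" s, OF assms(3)] assms(2) cover tree size
    unfolding R_def by blast
  define h where "h C = (SOME w. \<forall>v\<in>C. g v = w)" for C
  have h: "g v = h C" if "C \<in> \<C>" "v \<in> C" for C v
    unfolding h_def using someI_ex[OF const[OF that(1)]] that(2) by blast
  \<comment> \<open>Every quotient arc is the image of an arc between parts, under the map
    \<open>h\<close> from parts to labels.\<close>
  have "qarcs g \<subseteq> map_prod h h ` R"
  proof
    fix e assume "e \<in> qarcs g"
    then obtain u v where e: "e = (g u, g v)" "(u, v) \<in> A" "g u \<noteq> g v" by (auto simp: qarcs_def)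
    then have "u \<in> \<Union>\<C>" "v \<in> \<Union>\<C>" using arcD cover by auto
    then obtain C C' where C: "C \<in> \<C>" "u \<in> C" "C' \<in> \<C>" "v \<in> C'" by blast
    then have "(C, C') \<in> R" using e h by (auto simp: R_def)
    then show "e \<in> map_prod h h ` R" using e h C by force
  qed
  moreover have "finite R" using RV \<open>finite \<C>\<close> finite_subset by blast
  ultimately have "card (qarcs g) \<le> card R" by (rule surj_card_le[rotated])
  then have "real (card (qarcs g)) / (2 * real (card \<C>)) \<le> density G'"
    unfolding G'(3) by (intro divide_right_mono) auto
  then show ?thesis using G'(1,2) by blast
qed

text \<open>The parts are the chunks of the paths together with a singleton for each vertex off the
  paths; \<open>n\<close> is their number.\<close>

lemma path_minor:
  assumes "pair_graph G" and "V \<subseteq> pverts G" and "A \<subseteq> parcs G"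
    and finP: "finite P" and disjP: "disjoint_family_on set P" and sub: "\<Union>(set ` P) \<subseteq> V"
    and path: "\<And>p. p \<in> P \<Longrightarrow> successively (\<lambda>u v. (u, v) \<in> A) p \<and> distinct p"
    and const: "\<And>p. p \<in> P \<Longrightarrow> \<exists>w. \<forall>v\<in>set p. g v = w" and "0 < s" and "V \<noteq> {}"
  shows "\<exists>(G' :: 'a pair_pre_digraph) n. 0 < n \<and> pair_graph G' \<and> bounded_minor s G' G \<and>
    real (card (qarcs g)) / (2 * real n) \<le> density G' \<and>
    s * n \<le> card (\<Union>(set ` P)) + (s - 1) * card P + s * card (V - \<Union>(set ` P))"
proof -
  define good where "good p \<C> \<longleftrightarrow> finite \<C> \<and> \<Union>\<C> = set p \<and> disjoint \<C> \<and> \<C> \<subseteq> tree_sets A \<and>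
    (\<forall>C\<in>\<C>. card C \<le> s) \<and> s * card \<C> \<le> length p + (s - 1)" for p \<C>
  have "\<exists>\<C>. good p \<C>" if "p \<in> P" for p
    unfolding good_def using path[OF that] \<open>0 < s\<close> by (intro path_chunks) auto
  then obtain ch where "\<And>p. p \<in> P \<Longrightarrow> good p (ch p)" by metis
  note ch = this[unfolded good_def]
  let ?Y = "\<Union>(set ` P)"
  define \<C>1 where "\<C>1 = (\<Union>p\<in>P. ch p)"
  define \<C>2 where "\<C>2 = (\<lambda>v. {v}) ` (V - ?Y)"
  have fin: "finite \<C>1" "finite \<C>2" using finP ch finite_V by (auto simp: \<C>1_def \<C>2_def)
  have "\<Union>\<C>1 = (\<Union>p\<in>P. \<Union>(ch p))" by (auto simp: \<C>1_def)
  also have "\<dots> = ?Y" using ch by (intro SUP_cong) auto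
  finally have U1: "\<Union>\<C>1 = ?Y" .
  have U2: "\<Union>\<C>2 = V - ?Y" by (auto simp: \<C>2_def)
  have "disjoint \<C>1"
    unfolding pairwise_def disjnt_def
  proof (intro ballI impI)
    fix C C' assume C: "C \<in> \<C>1" "C' \<in> \<C>1" "C \<noteq> C'"
    then obtain p p' where p: "p \<in> P" "C \<in> ch p" "p' \<in> P" "C' \<in> ch p'" by (auto simp: \<C>1_def)
    show "C \<inter> C' = {}"
    proof (cases "p = p'")
      case True
      then show ?thesis using ch[OF p(1)] p C(3) by (auto simp: pairwise_def disjnt_def)
    next
      case False
      then have "set p \<inter> set p' = {}" using disjP p by (auto simp: disjoint_family_on_def)
      moreover have "C \<subseteq> set p" "C' \<subseteq> set p'" using ch p by blast+
      ultimately show ?thesis by blast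
    qed
  qed
  moreover have "disjoint \<C>2" by (auto simp: \<C>2_def pairwise_def disjnt_def)
  ultimately have disj: "disjoint (\<C>1 \<union> \<C>2)" using U1 U2 by (intro disjoint_union) auto
  have "s * card \<C>1 \<le> card ?Y + (s - 1) * card P"
  proof -
    have "s * card \<C>1 \<le> s * (\<Sum>p\<in>P. card (ch p))"
      unfolding \<C>1_def by (intro mult_le_mono2 card_UN_le finP)
    also have "\<dots> = (\<Sum>p\<in>P. s * card (ch p))" by (rule sum_distrib_left)
    also have "\<dots> \<le> (\<Sum>p\<in>P. card (set p) + (s - 1))"
      using ch path by (intro sum_mono) (simp add: distinct_card)
    also have "\<dots> = (\<Sum>p\<in>P. card (set p)) + (s - 1) * card P"
      by (simp add: sum.distrib mult.commute)
    also have "(\<Sum>p\<in>P. card (set p)) = card ?Y"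
      using finP disjP by (subst card_UN_disjoint) (auto simp: disjoint_family_on_def)
    finally show ?thesis .
  qed
  moreover have "card \<C>2 \<le> card (V - ?Y)"
    unfolding \<C>2_def using finite_V by (intro card_image_le) auto
  moreover have "card (\<C>1 \<union> \<C>2) \<le> card \<C>1 + card \<C>2" by (rule card_Un_le)
  ultimately have count: "s * card (\<C>1 \<union> \<C>2) \<le> card ?Y + (s - 1) * card P + s * card (V - ?Y)"
    by (smt (verit, best) add_le_mono add_mult_distrib2 le_trans mult_le_mono2)
  have "\<exists>G' :: 'a pair_pre_digraph. pair_graph G' \<and> bounded_minor s G' G \<and>
    real (card (qarcs g)) / (2 * real (card (\<C>1 \<union> \<C>2))) \<le> density G'"
  proof (rule quotient_minor[OF assms(1-3)])
    show "finite (\<C>1 \<union> \<C>2)" using fin by simp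
    show "\<Union>(\<C>1 \<union> \<C>2) = V" using U1 U2 sub by auto
    show "disjoint (\<C>1 \<union> \<C>2)" by fact
    show "\<C>1 \<union> \<C>2 \<subseteq> tree_sets A"
      using ch by (auto simp: \<C>1_def \<C>2_def intro: tree_sets.singleton)
    show "card C \<le> s" if "C \<in> \<C>1 \<union> \<C>2" for C
      using that ch \<open>0 < s\<close> by (auto simp: \<C>1_def \<C>2_def)
    show "\<exists>w. \<forall>v\<in>C. g v = w" if "C \<in> \<C>1 \<union> \<C>2" for C
      using that ch const unfolding \<C>1_def \<C>2_def by blast
  qed
  moreover have "\<C>1 \<union> \<C>2 \<noteq> {}" using U1 U2 sub \<open>V \<noteq> {}\<close> by blast
  then have "0 < card (\<C>1 \<union> \<C>2)" using fin by (simp add: card_gt_0_iff)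
  ultimately show ?thesis using count by blast
qed

end

text \<open>The situation after the search: \<open>D\<close> is the set of abandoned vertices, and
  the pieces are the completed paths and the single vertices of large degree. The pieces become the
  centres of the stars and \<open>D\<close> supplies their leaves.\<close>

locale pieces = simple_arcs V A for V :: "'a set" and A +
  fixes D :: "'a set" and \<P> :: "'a set set" and T :: nat
  assumes D_subset: "D \<subseteq> V" and finite_pieces: "finite \<P>" and disjoint_pieces: "disjoint \<P>"
    and pieces_cover: "\<Union>\<P> = V - D"
    and piece_tree: "Q \<in> \<P> \<Longrightarrow> Q \<in> tree_sets A"
    and piece_size: "Q \<in> \<P> \<Longrightarrow> card Q \<le> T"
begin

definition nbr :: "'a \<Rightarrow> 'a set set" where
  "nbr x = {Q \<in> \<P>. A `` {x} \<inter> Q \<noteq> {}}"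

definition piece :: "'a \<Rightarrow> 'a set" where
  "piece v = (SOME Q. Q \<in> \<P> \<and> v \<in> Q)"

lemma piece_eq: "Q \<in> \<P> \<Longrightarrow> v \<in> Q \<Longrightarrow> piece v = Q"
  unfolding piece_def using disjoint_pieces
  by (intro some_equality) (auto simp: pairwise_def disjnt_def)

lemma finite_nbr: "finite (nbr x)"
  using finite_pieces by (simp add: nbr_def)

text \<open>Disjoint pieces adjacent to \<open>x\<close> contain distinct neighbours of
  \<open>x\<close>.\<close>

lemma card_pieces_le:
  assumes "\<Q> \<subseteq> nbr x"
  shows "card \<Q> \<le> card (A `` {x} \<inter> \<Union>\<Q>)"
proof (rule surj_card_le)
  show "finite (A `` {x} \<inter> \<Union>\<Q>)" using finite_nbrs by blast
  show "\<Q> \<subseteq> piece ` (A `` {x} \<inter> \<Union>\<Q>)"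
  proof
    fix Q assume Q: "Q \<in> \<Q>"
    then obtain v where "v \<in> A `` {x} \<inter> Q" "Q \<in> \<P>" using assms by (auto simp: nbr_def)
    then show "Q \<in> piece ` (A `` {x} \<inter> \<Union>\<Q>)" using Q piece_eq[of Q v] by auto
  qed
qed

lemma card_nbr_le: "card (nbr x) \<le> card (A `` {x})"
  using card_pieces_le[of "nbr x" x] card_mono[OF finite_nbrs, of "A `` {x} \<inter> \<Union>(nbr x)" "{x}"]
  by simp

text \<open>Arcs from \<open>x\<close> in \<open>D\<close> into one piece share their image in the
  quotient, so they contribute at most \<open>card (nbr x)\<close>. As the quotient keeps most arcs,
  vertices of \<open>D\<close> must on average see almost as many pieces as they have neighbours.
  Both sides are sums to avoid truncated subtraction.\<close>

lemma card_qarcs_le_nbr: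
  assumes const: "\<And>Q. Q \<in> \<P> \<Longrightarrow> \<exists>w. \<forall>v\<in>Q. g v = w"
  shows "card (qarcs g) + card {(x, y) \<in> A. x \<in> D} \<le>
    (\<Sum>x\<in>D. card (nbr x)) + card A + card {(x, y) \<in> A. x \<in> D \<and> y \<in> D \<and> g x \<noteq> g y}"
proof -
  define A1 where "A1 = {(x, y) \<in> A. x \<in> D}"
  define X where "X = {(x, y) \<in> A. x \<in> D \<and> y \<in> D \<and> g x \<noteq> g y}"
  define N where "N = (SIGMA x : D. nbr x)"
  define h where "h Q = (SOME w. \<forall>v\<in>Q. g v = w)" for Q
  have h: "g v = h Q" if "Q \<in> \<P>" "v \<in> Q" for Q v
    unfolding h_def using someI_ex[OF const[OF that(1)]] that(2) by blast
  have fin: "finite D" "finite A1" "finite X" "finite N"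
    using finite_subset[OF D_subset finite_V] finite_A finite_nbr
    by (auto simp: A1_def X_def N_def intro: finite_subset)
  have "qarcs g \<subseteq> map_prod g g ` (A - A1 \<union> X) \<union> map_prod g h ` N"
  proof
    fix e assume "e \<in> qarcs g"
    then obtain u v where e: "e = (g u, g v)" "(u, v) \<in> A" "g u \<noteq> g v" by (auto simp: qarcs_def)
    show "e \<in> map_prod g g ` (A - A1 \<union> X) \<union> map_prod g h ` N"
    proof (cases "u \<in> D \<and> v \<notin> D")
      case True
      then have "v \<in> \<Union>\<P>" using e(2) arcD pieces_cover by auto
      then obtain Q where Q: "Q \<in> \<P>" "v \<in> Q" by blast
      then have "(u, Q) \<in> N" using e True by (auto simp: N_def nbr_def)
      then have "map_prod g h (u, Q) \<in> map_prod g h ` N" by (rule imageI)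
      then show ?thesis using e(1) h[OF Q] by simp
    next
      case False
      then have "(u, v) \<in> A - A1 \<union> X" using e by (auto simp: A1_def X_def)
      then have "map_prod g g (u, v) \<in> map_prod g g ` (A - A1 \<union> X)" by (rule imageI)
      then show ?thesis using e(1) by simp
    qed
  qed
  then have "card (qarcs g) \<le> card (map_prod g g ` (A - A1 \<union> X) \<union> map_prod g h ` N)"
    using fin finite_A by (intro card_mono) auto
  also have "\<dots> \<le> card (map_prod g g ` (A - A1 \<union> X)) + card (map_prod g h ` N)" by (rule card_Un_le)
  also have "\<dots> \<le> card (A - A1 \<union> X) + card N"
    using fin finite_A by (intro add_mono card_image_le) auto
  also have "card (A - A1 \<union> X) \<le> card (A - A1) + card X" by (rule card_Un_le)
  finally have "card (qarcs g) \<le> card (A - A1) + card X + card N" by simp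
  moreover have "A1 \<subseteq> A" by (auto simp: A1_def)
  then have "card (A - A1) + card A1 = card A"
    using card_Diff_subset[OF fin(2)] card_mono[OF finite_A] by simp
  moreover have "card N = (\<Sum>x\<in>D. card (nbr x))"
    unfolding N_def using fin finite_nbr by (intro card_SigmaI) auto
  ultimately show ?thesis unfolding A1_def X_def by simp
qed

text \<open>The counterpart of \<open>dense_around_class\<close> for pieces: a mate \<open>y\<close>
  has a neighbour in each piece that it shares with \<open>x\<close>.\<close>

lemma dense_around_vertex:
  assumes M: "M \<subseteq> D" "finite M" and mates: "\<And>y. y \<in> M \<Longrightarrow> m \<le> real (card (nbr x \<inter> nbr y))"
  defines "W \<equiv> M \<union> \<Union>(nbr x)"
  shows "W \<subseteq> V" and "card W \<le> card M + T * card (A `` {x})"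
    and "real (card M) * m \<le> real (card (A \<inter> W \<times> W))"
proof -
  show "W \<subseteq> V" using M D_subset pieces_cover by (auto simp: W_def nbr_def)
  have "card W \<le> card M + card (\<Union>(nbr x))" unfolding W_def by (rule card_Un_le)
  also have "card (\<Union>(nbr x)) \<le> (\<Sum>Q\<in>nbr x. card Q)" using card_UN_le[OF finite_nbr, of "\<lambda>Q. Q"] by simp
  also have "\<dots> \<le> (\<Sum>Q\<in>nbr x. T)" using piece_size by (intro sum_mono) (auto simp: nbr_def)
  also have "\<dots> \<le> T * card (A `` {x})" using card_nbr_le by (simp add: mult.commute)
  finally show "card W \<le> card M + T * card (A `` {x})" by simp
  have each: "m \<le> real (card ((A \<inter> W \<times> W) `` {y}))" if y: "y \<in> M" for y
  proof -
    have "card (nbr x \<inter> nbr y) \<le> card (A `` {y} \<inter> \<Union>(nbr x \<inter> nbr y))"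
      by (rule card_pieces_le) auto
    also have "\<dots> \<le> card ((A \<inter> W \<times> W) `` {y})"
      using finite_A y by (intro card_mono) (auto simp: W_def)
    finally show ?thesis using mates[OF y] by linarith
  qed
  have "real (card M) * m \<le> (\<Sum>y\<in>M. real (card ((A \<inter> W \<times> W) `` {y})))"
    using each sum_mono[of M "\<lambda>_. m"] by simp
  also have "\<dots> = real (card (SIGMA y : M. (A \<inter> W \<times> W) `` {y}))"
    using M(2) finite_A by (subst card_SigmaI) auto
  also have "\<dots> \<le> real (card (A \<inter> W \<times> W))"
    using finite_A by (intro of_nat_mono card_mono) auto
  finally show "real (card M) * m \<le> real (card (A \<inter> W \<times> W))" .
qed

text \<open>A branch set is a piece with its \<open>r\<close> leaves. Each leaf sees at least
  \<open>\<delta>\<close> pieces, fewer than \<open>m\<close> of them outside the chosen family, and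
  two leaves of one star share fewer than \<open>m\<close>. The Bonferroni bound then gives the
  number of other stars adjacent to a star.\<close>

lemma star_minor:
  fixes m \<delta> :: real
  assumes "pair_graph G" and "V \<subseteq> pverts G" and "A \<subseteq> parcs G"
    and XD: "X \<subseteq> D" and large: "r * card \<P> < card X"
    and deg: "\<And>x. x \<in> X \<Longrightarrow> \<delta> \<le> real (card (nbr x))" and "m \<le> \<delta>"
    and few: "\<And>x. x \<in> X \<Longrightarrow> real (card {y \<in> X. y \<noteq> x \<and> m \<le> real (card (nbr x \<inter> nbr y))}) < m"
  shows "\<exists>G' :: 'a pair_pre_digraph. pair_graph G' \<and> bounded_minor (T + r) G' G \<and>
    (real r * (\<delta> - m) - m * (real r * (real r - 1) / 2) - 1) / 2 \<le> density G'"
proof -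
  define mate where "mate x y \<longleftrightarrow> y \<noteq> x \<and> m \<le> real (card (nbr x \<inter> nbr y))" for x y
  interpret star_packing X \<P> nbr mate r
  proof
    show "finite X" using XD D_subset finite_V by (meson finite_subset)
    show "finite \<P>" by (rule finite_pieces)
    show "nbr x \<subseteq> \<P>" for x by (auto simp: nbr_def)
    show "mate x y \<Longrightarrow> mate y x" for x y by (auto simp: mate_def Int_commute)
    show "card {y \<in> X. mate x y} < card (nbr x)" if "x \<in> X" for x
    proof -
      have "real (card {y \<in> X. mate x y}) < real (card (nbr x))"
        using few[OF that] deg[OF that] \<open>m \<le> \<delta>\<close> by (simp add: mate_def)
      then show ?thesis by simp
    qed
  qed (rule large)
  obtain Z S where Z: "Z \<subseteq> \<P>" "Z \<noteq> {}"
    and SX: "\<And>z. z \<in> Z \<Longrightarrow> S z \<subseteq> X" and cardS: "\<And>z. z \<in> Z \<Longrightarrow> card (S z) = r"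
    and disjS: "disjoint_family_on S Z"
    and S_nbr: "\<And>x z. z \<in> Z \<Longrightarrow> x \<in> S z \<Longrightarrow> z \<in> nbr x"
    and nomate: "\<And>x y z. z \<in> Z \<Longrightarrow> x \<in> S z \<Longrightarrow> y \<in> S z \<Longrightarrow> x \<noteq> y \<Longrightarrow> \<not> mate x y"
    and outside: "\<And>x z. z \<in> Z \<Longrightarrow> x \<in> S z \<Longrightarrow> card (nbr x - Z) \<le> card {y \<in> X. mate x y}"
    by (rule saturated_stars, rule that)
  have finZ: "finite Z" using Z(1) finite_pieces by (rule finite_subset)
  have finS: "finite (S z)" if "z \<in> Z" for z using SX[OF that] finite_X by (rule finite_subset)
  define N where "N z = (\<Union>x\<in>S z. nbr x \<inter> Z)" for z
  \<comment> \<open>Adjacency is recorded only as seen from the leaves of \<open>z\<close>, hence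
    not symmetrically; symmetrising can only add arcs.\<close>
  define R0 where "R0 = (SIGMA z : Z. N z - {z})"
  define R where "R = R0 \<union> R0\<inverse>"
  have finN: "finite (N z)" for z using finite_subset[OF _ finZ, of "N z"] by (auto simp: N_def)
  have R0: "R0 \<subseteq> Z \<times> Z" by (auto simp: R0_def N_def)
  have simple: "simple_arcs Z R"
    using finZ R0 by unfold_locales (auto simp: R_def R0_def sym_def irrefl_def)
  define B where "B z = z \<union> S z" for z
  have tree: "B z \<in> tree_sets A" if z: "z \<in> Z" for z
  proof -
    have "z \<union> S' \<in> tree_sets A" if "finite S'" "S' \<subseteq> S z" for S'
      using that
    proof (induction S' rule: finite_induct)
      case empty
      then show ?case using z Z(1) piece_tree by auto
    next
      case (insert x S')
      then obtain v where "v \<in> z" "(x, v) \<in> A" using S_nbr[OF z, of x] by (auto simp: nbr_def)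
      then have "insert x (z \<union> S') \<in> tree_sets A"
        using insert arc_sym by (intro tree_sets.insert[of _ _ v]) auto
      then show ?case by simp
    qed
    then show ?thesis using finS[OF z] by (simp add: B_def)
  qed
  have zV: "z \<subseteq> V - D" if "z \<in> Z" for z using that Z(1) pieces_cover by blast
  have "\<exists>G' :: 'a pair_pre_digraph. pair_graph G' \<and> bounded_minor (T + r) G' G \<and>
    density G' = real (card R) / (2 * real (card Z))"
  proof (rule bounded_minor_of_family[OF assms(3) simple tree])
    show "B z \<subseteq> pverts G" if "z \<in> Z" for z
      unfolding B_def using zV[OF that] SX[OF that] XD D_subset assms(2) by blast
    show "card (B z) \<le> T + r" if "z \<in> Z" for z
      using card_Un_le[of z "S z"] cardS[OF that] piece_size[of z] that Z(1) by (auto simp: B_def)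
    show "disjoint_family_on B Z"
      unfolding disjoint_family_on_def
    proof (intro ballI impI)
      fix z z' assume zz: "z \<in> Z" "z' \<in> Z" "z \<noteq> z'"
      have "z \<inter> z' = {}" using zz Z(1) disjoint_pieces by (auto simp: pairwise_def disjnt_def)
      moreover have "S z \<inter> S z' = {}" using zz disjS by (auto simp: disjoint_family_on_def)
      moreover have "S z \<subseteq> D" "S z' \<subseteq> D" using SX zz XD by blast+
      ultimately show "B z \<inter> B z' = {}" using zV[OF zz(1)] zV[OF zz(2)] by (auto simp: B_def)
    qed
    have R0_adj: "\<exists>u\<in>B z. \<exists>v\<in>B z'. (u, v) \<in> A" if zz': "(z, z') \<in> R0" for z z'
    proof -
      obtain x where "x \<in> S z" "z' \<in> nbr x" using zz' by (auto simp: R0_def N_def)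
      then show ?thesis by (auto simp: nbr_def B_def)
    qed
    show "\<exists>u\<in>B z. \<exists>v\<in>B z'. (u, v) \<in> A" if "(z, z') \<in> R" for z z'
      using that R0_adj[of z z'] R0_adj[of z' z] arc_sym by (auto simp: R_def)
  qed
  then obtain G' :: "'a pair_pre_digraph" where G': "pair_graph G'" "bounded_minor (T + r) G' G"
    "density G' = real (card R) / (2 * real (card Z))" by blast
  define b where "b = real r * (\<delta> - m) - m * (real r * (real r - 1) / 2) - 1"
  have each: "b \<le> real (card (N z - {z}))" if z: "z \<in> Z" for z
  proof -
    have "\<delta> - m \<le> real (card (nbr x \<inter> Z))" if x: "x \<in> S z" for x
    proof -
      have xX: "x \<in> X" using x SX z by auto
      have "card (nbr x) = card (nbr x \<inter> Z) + card (nbr x - Z)"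
        by (subst card_Un_disjoint[symmetric]) (auto simp: finite_nbr intro: arg_cong[where f = card])
      moreover have "real (card (nbr x - Z)) < m"
        using outside[OF z x] few[OF xX] by (simp add: mate_def)
      ultimately show ?thesis using deg[OF xX] by simp
    qed
    then have "real r * (\<delta> - m) \<le> (\<Sum>x\<in>S z. real (card (nbr x \<inter> Z)))"
      using sum_mono[of "S z" "\<lambda>_. \<delta> - m"] cardS[OF z] by simp
    also have "\<dots> \<le> real (card (N z)) + m * (real (card (S z)) * (real (card (S z)) - 1) / 2)"
      unfolding N_def
    proof (rule card_UN_ge_sum_minus_pairs[OF finS[OF z]])
      fix x y assume xy: "x \<in> S z" "y \<in> S z" "x \<noteq> y"
      have "real (card (nbr x \<inter> nbr y)) < m"
        using nomate[OF z xy] xy(3) by (auto simp: mate_def)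
      moreover have "card (nbr x \<inter> Z \<inter> (nbr y \<inter> Z)) \<le> card (nbr x \<inter> nbr y)"
        using finite_nbr by (intro card_mono) auto
      ultimately show "real (card (nbr x \<inter> Z \<inter> (nbr y \<inter> Z))) \<le> m" by linarith
    qed (use finite_nbr in auto)
    finally have "real r * (\<delta> - m) \<le> real (card (N z)) + m * (real r * (real r - 1) / 2)"
      by (simp add: cardS[OF z])
    \<comment> \<open>The leaves also see their own centre, which accounts for the final
      \<open>- 1\<close>.\<close>
    moreover have "card (N z) \<le> card (N z - {z}) + 1"
      using card_Diff1_le[of "N z" z] finN[of z] by (cases "z \<in> N z") (auto simp: card_Suc_Diff1)
    then have "real (card (N z)) \<le> real (card (N z - {z})) + 1" by linarith
    ultimately show ?thesis unfolding b_def by linarith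
  qed
  have "real (card Z) * b \<le> (\<Sum>z\<in>Z. real (card (N z - {z})))"
    using each sum_mono[of Z "\<lambda>_. b"] by simp
  also have "\<dots> = real (card R0)" unfolding R0_def using finZ finN by (subst card_SigmaI) auto
  also have "\<dots> \<le> real (card R)"
    using simple_arcs.finite_A[OF simple] by (intro of_nat_mono card_mono) (auto simp: R_def)
  finally have "b * real (card Z) \<le> real (card R)" by (simp add: mult.commute)
  moreover have "0 < real (card Z)" using finZ Z(2) by (simp add: card_gt_0_iff)
  ultimately have "b / 2 \<le> density G'" unfolding G'(3) by (simp add: field_simps)
  then show ?thesis using G' unfolding b_def by blast
qed

end

section \<open>A minimal dense subgraph and the numerical estimate\<close>

text \<open>Minimise the number of vertices plus arcs among subgraphs of density at least d.\<close>

lemma minimal_dense_subgraph: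
  fixes d :: real
  assumes "simple_arcs V0 A0" and "V0 \<noteq> {}" and "0 < d" and "2 * d * real (card V0) \<le> real (card A0)"
  obtains V A where "simple_arcs V A" and "V \<subseteq> V0" and "A \<subseteq> A0" and "V \<noteq> {}"
    and "2 * d * real (card V) \<le> real (card A)" and "real (card A) < 2 * d * real (card V) + 2"
    and "\<And>x. x \<in> V \<Longrightarrow> d < real (card (A `` {x}))"
proof -
  define good where "good = (\<lambda>(V, A). simple_arcs V A \<and> V \<subseteq> V0 \<and> A \<subseteq> A0 \<and> V \<noteq> {} \<and>
    2 * d * real (card V) \<le> real (card A))"
  have "good (V0, A0)" using assms by (auto simp: good_def)
  then obtain VA where VA: "good VA" "\<And>y. good y \<Longrightarrow> card (fst VA) + card (snd VA) \<le> card (fst y) + card (snd y)"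
    using ex_has_least_nat[of good _ "\<lambda>y. card (fst y) + card (snd y)"] by blast
  obtain V A where [simp]: "VA = (V, A)" by (cases VA)
  have good: "simple_arcs V A" "V \<subseteq> V0" "A \<subseteq> A0" "V \<noteq> {}" "2 * d * real (card V) \<le> real (card A)"
    using VA(1) by (auto simp: good_def)
  interpret simple_arcs V A by fact
  have min: "real (card A') < 2 * d * real (card V')"
    if "simple_arcs V' A'" "V' \<subseteq> V" "A' \<subseteq> A" "V' \<noteq> {}" "card V' + card A' < card V + card A" for V' A'
    using VA(2)[of "(V', A')"] that good by (force simp: good_def)
  have "0 < card V" using good(4) finite_V by (simp add: card_gt_0_iff)
  then have "0 < 2 * d * real (card V)" using \<open>0 < d\<close> by simp
  then have "0 < card A" using good(5) by linarith
  then obtain u v where uv: "(u, v) \<in> A" by (metis card_gt_0_iff equals0I surj_pair)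
  have "real (card A) < 2 * d * real (card V) + 2"
  proof -
    \<comment> \<open>Deleting one edge must push the density below d, so \<open>card A\<close>
      exceeds the threshold by less than 2.\<close>
    let ?A = "A - {(u, v), (v, u)}"
    have card: "card ?A = card A - 2" "2 \<le> card A"
      using uv arc_sym[OF uv] arc_neq[OF uv] finite_A card_mono[of A "{(u, v), (v, u)}"]
      by (auto simp: card_Diff_subset)
    have "simple_arcs V ?A"
      using finite_V arcs_subset sym_A irrefl_A by unfold_locales (auto simp: sym_def irrefl_def)
    then have "real (card ?A) < 2 * d * real (card V)"
      using card good(4) by (intro min) auto
    then show ?thesis using card by (simp add: of_nat_diff)
  qed
  moreover have "d < real (card (A `` {x}))" if x: "x \<in> V" for x
  proof -
    let ?V = "V - {x}"
    let ?A = "A \<inter> ?V \<times> ?V"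
    \<comment> \<open>Deleting \<open>x\<close> costs at most twice its degree in arcs but lowers
      the threshold by \<open>2 * d\<close>; minimality makes the cost the larger one.\<close>
    have "A \<subseteq> ?A \<union> ({x} \<times> A `` {x} \<union> A `` {x} \<times> {x})" using arcD arc_sym by auto
    then have "card A \<le> card (?A \<union> ({x} \<times> A `` {x} \<union> A `` {x} \<times> {x}))"
      using finite_A finite_nbrs by (intro card_mono) auto
    also have "\<dots> \<le> card ?A + card ({x} \<times> A `` {x} \<union> A `` {x} \<times> {x})" by (rule card_Un_le)
    also have "card ({x} \<times> A `` {x} \<union> A `` {x} \<times> {x}) \<le> card ({x} \<times> A `` {x}) + card (A `` {x} \<times> {x})"
      by (rule card_Un_le)
    finally have le: "card A \<le> card ?A + 2 * card (A `` {x})" by (simp add: card_cartesian_product)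
    have cardV: "real (card V) = real (card ?V) + 1"
      using x finite_V \<open>0 < card V\<close> by (simp add: card_Diff_singleton of_nat_diff)
    have "?V \<noteq> {}"
    proof
      assume "?V = {}"
      then have "u = v" using uv arcD by blast
      then show False using arc_neq[OF uv] by simp
    qed
    moreover have "simple_arcs ?V ?A" by (rule induced_simple_arcs) auto
    moreover have "card ?V < card V" using x finite_V by (rule card_Diff1_less[rotated])
    moreover have "card ?A \<le> card A" using finite_A by (intro card_mono) auto
    ultimately have "real (card ?A) < 2 * d * real (card ?V)" by (intro min) auto
    then show ?thesis using le good(5) cardV by (simp add: algebra_simps)
  qed
  ultimately show thesis using that good by blast
qed

text \<open>Here \<open>v\<close>, \<open>x\<close>, \<open>b\<close> count all, abandoned and
  large-degree vertices, \<open>q\<close> the paths and \<open>n\<close> the parts of the path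
  minor. If \<open>n\<close> is too large for (ii), then \<open>D\<close>, even without its
  exceptional vertices, has more than \<open>r\<close> vertices per piece.\<close>

lemma many_leftover_vertices:
  fixes k l r T v b x n q :: real
  assumes "2 \<le> l" and "8 * l + 1 \<le> k" and "4 * l * r \<le> k + 4 * l - 1" and "0 \<le> r" and "T = k - r"
    and "0 < v" and "b * k \<le> 67 / 100 * v" and "q * T \<le> v" and "0 \<le> b" and "0 \<le> q"
    and "2 * v / l < n" and "(l + 1) * n \<le> (v - x - b) + l * q + (l + 1) * (x + b)"
  shows "r * (q + b) < x - (x + v) / (9 / 10 * k)"
proof -
  have k: "17 \<le> k" using assms(1,2) by linarith
  have lr: "l * r \<le> 3 / 8 * k" and lr1: "l * (r + 1) \<le> k / 2"
    using assms(2,3) by (simp_all add: algebra_simps)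
  have lT: "k * (l - 3 / 8) \<le> l * T" using lr unfolding assms(5) by (simp add: algebra_simps)
  have "l * r \<le> l * (k / 2)"
  proof -
    have "3 / 8 * k \<le> l * (k / 2)" using mult_right_mono[of 2 l "k / 2"] assms(1) k by linarith
    then show ?thesis using lr by linarith
  qed
  then have "r \<le> k / 2" using assms(1) by (simp add: mult_le_cancel_left_pos)
  then have T: "0 < T" using assms(5) k by linarith
  have pos: "0 < l - 3 / 8" using assms(1) by linarith
  have q1: "q * (k * (l - 3 / 8)) \<le> l * v"
  proof -
    have "q * (k * (l - 3 / 8)) \<le> q * (l * T)" using lT assms(10) by (rule mult_left_mono)
    also have "\<dots> = l * (q * T)" by simp
    also have "\<dots> \<le> l * v" using assms(1,8) by (intro mult_left_mono) auto
    finally show ?thesis .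
  qed
  \<comment> \<open>There are at most \<open>v / T\<close> paths, and \<open>T\<close> is at least
    \<open>k * (l - 3 / 8) / l\<close> by the bound on \<open>l * r\<close>.\<close>
  have q2: "l * (r + 1) * q \<le> v * (1 / 2 + 1 / 4 / l)"
  proof -
    have "l * (r + 1) * q \<le> k / 2 * q" using lr1 assms(10) by (rule mult_right_mono)
    also have "k / 2 * q \<le> l * v / (2 * (l - 3 / 8))"
      using q1 pos by (simp add: field_simps)
    also have "\<dots> \<le> v * (1 / 2 + 1 / 4 / l)"
    proof -
      have "l * l \<le> (l + 1 / 2) * (l - 3 / 8)"
        using assms(1) by (simp add: algebra_simps)
      then have "v * (l * l) \<le> v * ((l + 1 / 2) * (l - 3 / 8))"
        using assms(6) by (intro mult_left_mono) auto
      then show ?thesis using pos assms(1) by (simp add: field_simps)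
    qed
    finally show ?thesis .
  qed
  have b2: "l * (r + 1) * b \<le> 67 / 200 * v"
    using mult_right_mono[OF lr1 assms(9)] assms(7) by (simp add: mult.commute[of b k])
  \<comment> \<open>The count of parts, solved for the number of abandoned vertices.\<close>
  have x0: "v * (1 / l + 2 / l\<^sup>2) - b - q < x"
  proof -
    have "(l + 1) * (2 * v / l) < (l + 1) * n" using assms(1,11) by (intro mult_strict_left_mono) auto
    also have "\<dots> \<le> v + l * (x + b + q)" using assms(12) by (simp add: algebra_simps)
    finally have "(l + 1) * (2 * v) / l < v + l * (x + b + q)" by simp
    then show ?thesis using assms(1) by (simp add: field_simps power2_eq_square)
  qed
  define w where "w = 1 / (9 / 10 * k)"
  have w: "0 < w" "w * l \<le> 1 / (36 / 5)" "w < 1" "w \<le> 1 / (36 / 5) / l"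
    using k assms(1,2) by (auto simp: w_def field_simps)
  define \<alpha> where "\<alpha> = v / l"
  define Lq where "Lq = l * (r + 1) * q"
  define Lb where "Lb = l * (r + 1) * b"
  define Lr where "Lr = l * (r * (q + b))"
  define L1 where "L1 = l * (q + b)"
  define Lw where "Lw = v * (w * l)"
  define Lx where "Lx = l * (x - (x + v) * w)"
  have "0 \<le> \<alpha>" using assms(1,6) by (simp add: \<alpha>_def)
  have sum: "Lq + Lb = Lr + L1" by (simp add: Lq_def Lb_def Lr_def L1_def algebra_simps)
  have Lq: "Lq \<le> v / 2 + \<alpha> / 4" using q2 by (simp add: Lq_def \<alpha>_def algebra_simps)
  have Lb: "Lb \<le> 67 / 200 * v" using b2 by (simp only: Lb_def)
  have Lw: "Lw \<le> 5 / 36 * v" using mult_left_mono[OF w(2), of v] assms(6) by (simp add: Lw_def)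
  have "v + \<alpha> - L1 - Lw < Lx"
  proof -
    have "l * ((v * (1 / l + 2 / l\<^sup>2) - b - q) * (1 - w)) < l * (x * (1 - w))"
      using x0 w assms(1) by (intro mult_strict_left_mono mult_strict_right_mono) auto
    moreover have "l * ((v * (1 / l + 2 / l\<^sup>2) - b - q) * (1 - w)) = v * (1 + 2 / l) * (1 - w) - L1 * (1 - w)"
      using assms(1) by (simp add: L1_def field_simps power2_eq_square)
    moreover have "L1 * (1 - w) \<le> L1"
      using w assms(1,9,10) by (intro mult_left_le) (auto simp: L1_def)
    moreover have "v + \<alpha> \<le> v * (1 + 2 / l) * (1 - w)"
    proof -
      have "(1 + h) * (1 - w) \<ge> 1 + h - 2 * w" if "h * w \<le> 1 * w" for h
        using that by (simp add: algebra_simps)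
      moreover have "(2 / l) * w \<le> 1 * w" using w assms(1) by (intro mult_right_mono) auto
      ultimately have "(1 + 2 / l) * (1 - w) \<ge> 1 + 2 / l - 2 * w" by blast
      moreover have "2 * w \<le> 1 / l" using w(4) assms(1) by (simp add: field_simps)
      ultimately have "(1 + 2 / l) * (1 - w) \<ge> 1 + 1 / l" by (simp add: field_simps)
      then have "v * ((1 + 2 / l) * (1 - w)) \<ge> v * (1 + 1 / l)"
        using assms(6) by (intro mult_left_mono) auto
      then show ?thesis by (simp add: \<alpha>_def algebra_simps)
    qed
    moreover have "Lx = l * (x * (1 - w)) - Lw" by (simp add: Lx_def Lw_def algebra_simps)
    ultimately show ?thesis by linarith
  qed
  \<comment> \<open>After multiplication by \<open>l\<close> the paths, large-degree vertices and
    exceptional vertices cost fractions 1/2, 67/200 and 5/36 of \<open>v\<close>, less than 1 in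
    total; the \<open>\<alpha> / 4\<close> from the paths is covered by
    \<open>\<alpha>\<close>.\<close>
  then have "Lr < Lx" using sum Lq Lb Lw assms(6) \<open>0 \<le> \<alpha>\<close> by linarith
  then have "l * (r * (q + b)) < l * (x - (x + v) * w)" by (simp only: Lr_def Lx_def)
  then have "r * (q + b) < x - (x + v) * w" using assms(1) by (simp add: mult_less_cancel_left_pos)
  then show ?thesis by (simp add: w_def)
qed

section \<open>The theorem\<close>

text \<open>The main case: \<open>k\<close> exceeds \<open>8 * l\<close>, the graph has been reduced
  to a minimal one, and outcome (i) fails.\<close>

lemma (in simple_arcs) sparse_trichotomy:
  fixes k l :: nat and \<epsilon> d :: real and G :: "'a pair_pre_digraph"
  assumes "2 \<le> l" and "8 * l < k" and "0 < \<epsilon>" and "\<epsilon> < 1 / (6 * real k)" and "1 / \<epsilon> \<le> d"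
    and G: "pair_graph G" "V \<subseteq> pverts G" "A \<subseteq> parcs G" and "V \<noteq> {}"
    and lower: "2 * d * real (card V) \<le> real (card A)"
    and upper: "real (card A) < 2 * d * real (card V) + 2"
    and min_deg: "\<And>x. x \<in> V \<Longrightarrow> d < real (card (A `` {x}))"
    and no_dense: "\<not> (\<exists>H :: 'a pair_pre_digraph. pair_graph H \<and> subgraph (with_proj H) (with_proj G) \<and>
            real (card (pverts H)) \<le> 3 * real k ^ 3 * d \<and>
            real (card (edges H)) \<ge> \<epsilon>\<^sup>2 * d\<^sup>2 / 2)"
  shows "(\<exists>G' :: 'a pair_pre_digraph. pair_graph G' \<and> bounded_minor (l + 1) G' G \<and>
            density G' \<ge> real l / 2 * (1 - 6 * real k * \<epsilon>) * d) \<or>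
         (\<exists>G' :: 'a pair_pre_digraph. pair_graph G' \<and> bounded_minor k G' G \<and>
            density G' \<ge> real k / (8 * real l) * (1 - 2 * real k * \<epsilon>) * d)"
proof -
  define v where "v = real (card V)"
  define m where "m = \<epsilon> * d"
  \<comment> \<open>The summand \<open>4 * l - 1\<close> makes the division round up.\<close>
  define r where "r = (k + 4 * l - 1) div (4 * l)"
  define T where "T = k - r"
  define S where "S = {x \<in> V. real (card (A `` {x})) \<le> 3 * real k * d}"
  have k17: "17 \<le> k" using assms(1,2) by linarith
  have "0 < d" using assms(3,5) by (meson divide_pos_pos less_le_trans zero_less_one)
  have ke: "real k * \<epsilon> < 1 / 6" using assms(4) k17 by (simp add: field_simps)
  have "1 * \<epsilon> \<le> real k * \<epsilon>" using assms(3) k17 by (intro mult_right_mono) auto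
  then have eps: "\<epsilon> \<le> real k * \<epsilon>" by simp
  have m1: "1 \<le> m" using assms(3,5) by (simp add: m_def field_simps)
  have "6 * real k < 1 / \<epsilon>" using assms(3) ke k17 by (simp add: field_simps)
  then have d6k: "6 * real k < d" using assms(5) by linarith
  have d102: "102 < d" using d6k k17 by linarith
  have vd: "d < v"
  proof -
    obtain x where x: "x \<in> V" using \<open>V \<noteq> {}\<close> by blast
    have "card (A `` {x}) \<le> card V" using arcD finite_V by (intro card_mono) auto
    then show ?thesis using min_deg[OF x] by (simp add: v_def)
  qed
  have r_upper: "4 * l * r \<le> k + 4 * l - 1" unfolding r_def by (rule times_div_less_eq_dividend)
  have r_lower: "k \<le> 4 * l * r"
  proof -
    have "k + 4 * l - 1 < 4 * l * (r + 1)"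
      unfolding r_def using assms(1) dividend_less_times_div[of "4 * l" "k + 4 * l - 1"] by simp
    then show ?thesis by simp
  qed
  have r0: "0 < r" using r_lower k17 by (cases r) auto
  have "r \<le> k - 1"
  proof -
    have "8 * r \<le> 4 * l * r" using assms(1) by simp
    then show ?thesis using r_upper assms(2) k17 by linarith
  qed
  then have T: "0 < T" "T \<le> k" "T + r = k" using k17 by (auto simp: T_def)
  have "real (4 * l * r) \<le> real (k + 4 * l - 1)" using r_upper by (simp only: of_nat_le_iff)
  then have r_upper': "4 * real l * real r \<le> real k + 4 * real l - 1"
    using assms(1) by (simp add: of_nat_diff)
  have "real k \<le> real (4 * l * r)" using r_lower by (simp only: of_nat_le_iff)
  then have r_lower': "real k \<le> 4 * real l * real r" by simp
  \<comment> \<open>\<open>m * m\<close> arcs are exactly the edges required in (i), each counted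
    twice.\<close>
  have sparse: "real (card (A \<inter> W \<times> W)) < m * m"
    if "W \<subseteq> V" "real (card W) \<le> 3 * real k ^ 3 * d" for W
  proof (rule ccontr)
    assume "\<not> ?thesis"
    then have "2 * (\<epsilon>\<^sup>2 * d\<^sup>2 / 2) \<le> real (card (A \<inter> W \<times> W))"
      by (simp add: m_def power2_eq_square ac_simps)
    from dense_subgraph[OF G that this] show False using no_dense by blast
  qed
  have finS: "finite S" using finite_V by (simp add: S_def)
  interpret sparse_arcs V A S T m
  proof
    show "S \<subseteq> V" by (auto simp: S_def)
    show "0 < T" by (rule T(1))
    show "0 < m" using m1 by simp
    fix g :: "'a \<Rightarrow> 'a" and c
    assume size: "\<And>w. card {v \<in> V. g v = w} \<le> T" and cS: "{v \<in> V. g v = c} \<subseteq> S"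
      and cT: "card {v \<in> V. g v = c} < T"
    let ?M = "{y \<in> qarcs g `` {c}. (\<forall>v\<in>V. g v = y \<longleftrightarrow> v = y) \<and>
        m \<le> real (card (qarcs g `` {y} \<inter> insert c (qarcs g `` {c})))}"
    let ?W = "{v \<in> V. g v \<in> insert c (qarcs g `` {c})}"
    show "real (card ?M) < m"
    proof (rule ccontr)
      assume "\<not> ?thesis"
      then have M: "m \<le> real (card ?M)" by simp
      have W: "card ?W \<le> T * (1 + card (qarcs g `` {c}))" "real (card ?M) * m \<le> real (card (A \<inter> ?W \<times> ?W))"
        using dense_around_class[of g T ?M c m, OF size] by blast+
      have "real (card (qarcs g `` {c})) \<le> real (card {v \<in> V. g v = c}) * (3 * real k * d)"
        using cS by (intro card_class_nbrs) (auto simp: S_def)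
      also have "\<dots> \<le> (real T - 1) * (3 * real k * d)"
        using cT \<open>0 < d\<close> by (intro mult_right_mono) auto
      finally have "1 + real (card (qarcs g `` {c})) \<le> 1 + (real T - 1) * (3 * real k * d)" by simp
      \<comment> \<open>The class has at most \<open>T - 1\<close> vertices, so its label itself
        fits into the remaining \<open>3 * real k * d\<close>.\<close>
      also have "\<dots> \<le> real T * (3 * real k * d)"
      proof -
        have "1 \<le> 3 * real k * d" using d102 k17 mult_mono[of 1 "3 * real k" 1 d] by simp
        then show ?thesis by (simp add: algebra_simps)
      qed
      also have "\<dots> \<le> real k * (3 * real k * d)" using T \<open>0 < d\<close> by (intro mult_right_mono) auto
      finally have "real T * (1 + real (card (qarcs g `` {c}))) \<le> real k * (real k * (3 * real k * d))"
        using T(2) by (intro mult_mono) auto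
      moreover have "real (card ?W) \<le> real T * (1 + real (card (qarcs g `` {c})))"
        using W(1) by (metis of_nat_1 of_nat_add of_nat_le_iff of_nat_mult)
      ultimately have "real (card ?W) \<le> 3 * real k ^ 3 * d" by (simp add: power3_eq_cube algebra_simps)
      then have "real (card (A \<inter> ?W \<times> ?W)) < m * m" by (intro sparse) auto
      moreover have "m * m \<le> real (card ?M) * m" using M m1 by (intro mult_right_mono) auto
      ultimately show False using W(2) by linarith
    qed
  qed
  obtain g D P F where inv: "dfs_inv g {} D [] P F" using dfs_finished by blast
  define B where "B = V - S"
  define Y where "Y = \<Union>(set ` P)"
  have DY: "D \<union> Y = S" "D \<inter> Y = {}" using dfs_sets[OF inv] by (auto simp: Y_def)
  have SV: "S \<subseteq> V" by (auto simp: S_def)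
  have DV: "D \<subseteq> V" and YV: "Y \<subseteq> V" using DY SV by auto
  have fin: "finite D" "finite Y" "finite B" "finite P"
    using DV YV finite_V dfs_finite[OF inv] by (auto simp: B_def intro: finite_subset)
  have path: "successively (\<lambda>u v. (u, v) \<in> A) p" "distinct p" "\<exists>w. \<forall>v\<in>set p. g v = w" if "p \<in> P" for p
    using dfs_paths[OF inv] that by auto
  define b where "b = real (card B)"
  define x where "x = real (card D)"
  have v_split: "v = x + real (card Y) + b"
  proof -
    have "V = D \<union> Y \<union> B" using DY SV by (auto simp: B_def)
    then have "card V = card (D \<union> Y \<union> B)" by simp
    also have "\<dots> = card (D \<union> Y) + card B" using fin DY by (intro card_Un_disjoint) (auto simp: B_def)
    also have "card (D \<union> Y) = card D + card Y" using fin DY by (intro card_Un_disjoint) auto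
    finally show ?thesis by (simp add: v_def x_def b_def)
  qed
  have few_big: "b * real k \<le> 67 / 100 * v"
  proof -
    have "b * (3 * real k * d) = (\<Sum>y\<in>B. 3 * real k * d)" by (simp add: b_def)
    also have "\<dots> \<le> (\<Sum>y\<in>B. real (card (A `` {y})))"
      by (intro sum_mono) (auto simp: B_def S_def)
    also have "\<dots> = real (card (SIGMA y : B. A `` {y}))"
      using fin finite_nbrs by (subst card_SigmaI) auto
    also have "\<dots> \<le> real (card A)" using finite_A by (intro of_nat_mono card_mono) auto
    also have "\<dots> \<le> 2 * d * v + 2" using upper by (simp add: v_def)
    \<comment> \<open>Since d and \<open>v\<close> exceed 102, the additive 2 is below one percent
      of \<open>d * v\<close>; dividing by 3 yields the constant 67/100.\<close>
    also have "\<dots> \<le> 201 / 100 * (d * v)"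
      using mult_mono[of 102 d 102 v] d102 vd by simp
    finally have "(b * real k) * (3 * d) \<le> (67 / 100 * v) * (3 * d)" by (simp add: algebra_simps)
    then show ?thesis using \<open>0 < d\<close> by simp
  qed
  have paths_T: "real (card P) * real T \<le> v"
  proof -
    have "T * card P \<le> card S" using dfs_count[OF inv] by simp
    also have "\<dots> \<le> card V" using SV finite_V by (rule card_mono[rotated])
    finally show ?thesis unfolding v_def by (metis mult.commute of_nat_le_iff of_nat_mult)
  qed
  have loss: "real (card A) - 2 * m * v \<le> real (card (qarcs g))"
  proof -
    have "real (card A) \<le> real (card (qarcs g)) + 2 * m * real (card S)" using dfs_loss[OF inv] by simp
    moreover have "2 * m * real (card S) \<le> 2 * m * v"
      using m1 card_mono[OF finite_V SV] by (intro mult_left_mono) (auto simp: v_def)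
    ultimately show ?thesis by linarith
  qed
  obtain G1 :: "'a pair_pre_digraph" and n where G1: "0 < n" "pair_graph G1" "bounded_minor (l + 1) G1 G"
    "real (card (qarcs g)) / (2 * real n) \<le> density G1"
    "(l + 1) * n \<le> card Y + (l + 1 - 1) * card P + (l + 1) * card (V - Y)"
    using path_minor[OF G fin(4) dfs_disjoint[OF inv], of g "l + 1"] path YV \<open>V \<noteq> {}\<close>
    unfolding Y_def by auto
  show ?thesis
  proof (cases "real n \<le> 2 * v / real l")
    case True
    \<comment> \<open>With few parts, (ii) holds even with \<open>1 - \<epsilon>\<close> in place of
      \<open>1 - 6 * real k * \<epsilon>\<close>.\<close>
    have "real l / 2 * (1 - 6 * real k * \<epsilon>) * d \<le> real l / 2 * (1 - \<epsilon>) * d"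
      using k17 assms(3) \<open>0 < d\<close> by (intro mult_right_mono mult_left_mono) auto
    also have "\<dots> \<le> density G1"
    proof -
      have n: "real n * real l \<le> 2 * v" using True assms(1) by (simp add: field_simps)
      have e1: "0 \<le> 1 - \<epsilon>" using eps ke by linarith
      have "real l / 2 * (1 - \<epsilon>) * d * (2 * real n) = (real n * real l) * ((1 - \<epsilon>) * d)" by simp
      also have "\<dots> \<le> (2 * v) * ((1 - \<epsilon>) * d)" using n e1 \<open>0 < d\<close> by (intro mult_right_mono) auto
      also have "\<dots> = 2 * d * v - 2 * m * v" by (simp add: m_def algebra_simps)
      also have "\<dots> \<le> real (card (qarcs g))" using loss lower by (simp add: v_def)
      finally have "real l / 2 * (1 - \<epsilon>) * d \<le> real (card (qarcs g)) / (2 * real n)"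
        using G1(1) by (simp add: field_simps)
      then show ?thesis using G1(4) by linarith
    qed
    finally show ?thesis using G1(2,3) by blast
  next
    case False
    define \<P> where "\<P> = set ` P \<union> (\<lambda>y. {y}) ` B"
    interpret pieces V A D \<P> T
    proof
      show "D \<subseteq> V" by (rule DV)
      show "finite \<P>" using fin by (simp add: \<P>_def)
      show "\<Union>\<P> = V - D" using DY SV by (auto simp: \<P>_def B_def Y_def)
      have 1: "disjoint (set ` P)"
        using dfs_disjoint[OF inv] by (rule disjoint_family_on_disjoint_image)
      have 2: "disjoint ((\<lambda>y. {y}) ` B)" by (auto simp: pairwise_def disjnt_def)
      have "Y \<inter> B = {}" using DY by (auto simp: B_def)
      then show "disjoint \<P>" unfolding \<P>_def using 1 2 by (intro disjoint_union) (auto simp: Y_def)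
      fix Q assume Q: "Q \<in> \<P>"
      show "Q \<in> tree_sets A"
        using Q path(1) dfs_nonempty[OF inv]
        by (auto simp: \<P>_def intro: tree_sets.singleton successively_tree_set)
      show "card Q \<le> T"
      proof (cases "Q \<in> set ` P")
        case True
        then obtain p w where p: "p \<in> P" "Q = set p" "\<forall>v\<in>set p. g v = w" using path(3) by blast
        then have "Q \<subseteq> class_of g w" using YV by (auto simp: class_of_def Y_def)
        then have "card Q \<le> card (class_of g w)" by (rule card_mono[OF finite_class])
        also have "\<dots> \<le> T" using dfs_class[OF inv] by blast
        finally show ?thesis .
      next
        case False
        then show ?thesis using Q T(1) by (auto simp: \<P>_def)
      qed
    qed
    have const: "\<exists>w. \<forall>v\<in>Q. g v = w" if "Q \<in> \<P>" for Q using that path(3) by (auto simp: \<P>_def)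
    have card_pieces: "real (card \<P>) \<le> real (card P) + b"
    proof -
      have "card \<P> \<le> card (set ` P) + card ((\<lambda>y. {y}) ` B)" unfolding \<P>_def by (rule card_Un_le)
      also have "\<dots> \<le> card P + card B" using fin by (intro add_mono card_image_le) auto
      finally show ?thesis by (simp add: b_def)
    qed
    \<comment> \<open>Outcome (iii) may lose \<open>2 * real k * m\<close>. The factor 9/5 leaves
      \<open>real k * m / 5\<close> for mates and overlaps, while still making few vertices of
      \<open>D\<close> fall below \<open>\<delta>\<close>.\<close>
    define \<delta> where "\<delta> = (1 - 9 / 5 * real k * \<epsilon>) * d"
    define X where "X = {y \<in> D. \<delta> \<le> real (card (nbr y))}"
    have finX: "finite X" using fin by (simp add: X_def)
    have cross: "real (card {(y, z) \<in> A. y \<in> D \<and> z \<in> D \<and> g y \<noteq> g z}) \<le> 2 * m * x"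
    proof -
      have finF: "finite F" using dfs_paid_arcs[OF inv] finite_A by (rule finite_subset)
      \<comment> \<open>\<open>F\<close> holds each such arc in at least one of its two
        directions.\<close>
      have "{(y, z) \<in> A. y \<in> D \<and> z \<in> D \<and> g y \<noteq> g z} \<subseteq> F \<union> F\<inverse>"
        using dfs_paid[OF inv] by auto
      then have "card {(y, z) \<in> A. y \<in> D \<and> z \<in> D \<and> g y \<noteq> g z} \<le> card (F \<union> F\<inverse>)"
        using finF by (intro card_mono) auto
      also have "\<dots> \<le> card F + card (F\<inverse>)" by (rule card_Un_le)
      finally show ?thesis using dfs_card_paid[OF inv] by (simp add: x_def)
    qed
    have deg_sum: "(\<Sum>y\<in>D. real (card (A `` {y})) - real (card (nbr y))) \<le> 2 * m * (x + v)"
    proof -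
      have "{(y, z) \<in> A. y \<in> D} = (SIGMA y : D. A `` {y})" by auto
      then have "card {(y, z) \<in> A. y \<in> D} = (\<Sum>y\<in>D. card (A `` {y}))"
        using fin finite_nbrs by (simp add: card_SigmaI)
      then have "card (qarcs g) + (\<Sum>y\<in>D. card (A `` {y})) \<le> (\<Sum>y\<in>D. card (nbr y)) + card A +
        card {(y, z) \<in> A. y \<in> D \<and> z \<in> D \<and> g y \<noteq> g z}"
        using card_qarcs_le_nbr[OF const] by simp
      then have "real (card (qarcs g)) + (\<Sum>y\<in>D. real (card (A `` {y}))) \<le>
        (\<Sum>y\<in>D. real (card (nbr y))) + real (card A) +
        real (card {(y, z) \<in> A. y \<in> D \<and> z \<in> D \<and> g y \<noteq> g z})"
        by (simp only: of_nat_le_iff flip: of_nat_sum of_nat_add)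
      then show ?thesis using cross loss by (simp add: sum_subtractf algebra_simps)
    qed
    have bad: "real (card (D - X)) \<le> (x + v) / (9 / 10 * real k)"
    proof -
      \<comment> \<open>Markov's inequality: each vertex of \<open>D - X\<close> misses more than
        \<open>9 / 5 * real k * m\<close> of its degree, and \<open>deg_sum\<close> bounds the total
        shortfall.\<close>
      have "real (card (D - X)) * (9 / 5 * real k * m) = (\<Sum>y\<in>D - X. 9 / 5 * real k * m)" by simp
      also have "\<dots> \<le> (\<Sum>y\<in>D - X. real (card (A `` {y})) - real (card (nbr y)))"
      proof (rule sum_mono)
        fix y assume y: "y \<in> D - X"
        then have "real (card (nbr y)) < \<delta>" by (auto simp: X_def)
        moreover have "d < real (card (A `` {y}))" using y DV by (intro min_deg) auto
        ultimately show "9 / 5 * real k * m \<le> real (card (A `` {y})) - real (card (nbr y))"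
          by (simp add: \<delta>_def m_def algebra_simps)
      qed
      also have "\<dots> \<le> (\<Sum>y\<in>D. real (card (A `` {y})) - real (card (nbr y)))"
        using fin card_nbr_le by (intro sum_mono2) auto
      also have "\<dots> \<le> 2 * m * (x + v)" by (rule deg_sum)
      finally have "(real (card (D - X)) * (9 / 10 * real k)) * (2 * m) \<le> (x + v) * (2 * m)"
        by (simp add: algebra_simps)
      then have "real (card (D - X)) * (9 / 10 * real k) \<le> x + v" using m1 by (simp add: ac_simps)
      then show ?thesis using k17 by (simp add: field_simps)
    qed
    have large: "r * card \<P> < card X"
    proof -
      have "real r * (real (card P) + b) < x - (x + v) / (9 / 10 * real k)"
      proof (rule many_leftover_vertices[of "real l" "real k" "real r" "real T" v b "real (card P)" "real n"])
        show "2 * v / real l < real n" using False by simp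
        have "V - Y = D \<union> B" using DY SV by (auto simp: B_def)
        moreover have "card (D \<union> B) = card D + card B"
          using fin DY by (intro card_Un_disjoint) (auto simp: B_def)
        ultimately have "(l + 1) * n \<le> card Y + l * card P + (l + 1) * (card D + card B)"
          using G1(5) by simp
        then have "real ((l + 1) * n) \<le> real (card Y + l * card P + (l + 1) * (card D + card B))"
          by (simp only: of_nat_le_iff)
        then show "(real l + 1) * real n \<le> v - x - b + real l * real (card P) + (real l + 1) * (x + b)"
          by (simp add: v_split x_def b_def distrib_right)
        show "real T = real k - real r" using T(3) by linarith
        show "0 < v" using vd d102 by linarith
      qed (use assms(1,2) r_upper' few_big paths_T in \<open>auto simp: b_def\<close>)
      also have "\<dots> \<le> real (card X)"
      proof -
        have "card D = card X + card (D - X)"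
          using fin finX by (subst card_Un_disjoint[symmetric]) (auto simp: X_def intro: arg_cong[where f = card])
        then show ?thesis using bad by (simp add: x_def)
      qed
      finally have "real r * (real (card P) + b) < real (card X)" .
      moreover have "real r * real (card \<P>) \<le> real r * (real (card P) + b)"
        using card_pieces by (intro mult_left_mono) auto
      ultimately have "real (r * card \<P>) < real (card X)" by simp
      then show ?thesis by (simp only: of_nat_less_iff)
    qed
    have md: "m \<le> \<delta>"
    proof -
      have "\<epsilon> \<le> 1 - 9 / 5 * real k * \<epsilon>" using eps ke by linarith
      then show ?thesis unfolding m_def \<delta>_def using \<open>0 < d\<close> by (intro mult_right_mono) auto
    qed
    have few: "real (card {z \<in> X. z \<noteq> y \<and> m \<le> real (card (nbr y \<inter> nbr z))}) < m" if y: "y \<in> X" for y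
    proof (rule ccontr)
      let ?M = "{z \<in> X. z \<noteq> y \<and> m \<le> real (card (nbr y \<inter> nbr z))}"
      assume "\<not> ?thesis"
      then have "m \<le> real (card ?M)" by simp
      \<comment> \<open>Just enough mates are kept, because they count towards the size of the dense
        subgraph.\<close>
      then have "nat \<lceil>m\<rceil> \<le> card ?M" by (simp add: nat_le_iff ceiling_le_iff)
      then obtain M where M: "M \<subseteq> ?M" "card M = nat \<lceil>m\<rceil>" "finite M"
        using obtain_subset_with_card_n[of "nat \<lceil>m\<rceil>" ?M] by blast
      have cM: "m \<le> real (card M)" "real (card M) \<le> m + 1" using M(2) m1 by linarith+
      let ?W = "M \<union> \<Union>(nbr y)"
      have "M \<subseteq> D" using M(1) by (auto simp: X_def)
      then have W: "?W \<subseteq> V" "card ?W \<le> card M + T * card (A `` {y})"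
        "real (card M) * m \<le> real (card (A \<inter> ?W \<times> ?W))"
        using M by (intro dense_around_vertex; auto)+
      have "real (card (A `` {y})) \<le> 3 * real k * d" using y DY by (auto simp: X_def S_def)
      \<comment> \<open>Since \<open>r\<close> is positive, \<open>T\<close> is at most
        \<open>k - 1\<close>, which leaves \<open>3 * real k * d\<close> for the mates.\<close>
      then have "real T * real (card (A `` {y})) \<le> (real k - 1) * (3 * real k * d)"
        using T r0 by (intro mult_mono) auto
      moreover have "real (card ?W) \<le> real (card M) + real T * real (card (A `` {y}))"
        using W(2) by (metis of_nat_add of_nat_le_iff of_nat_mult)
      moreover have "m + 1 \<le> 3 * real k * d"
      proof -
        have "\<epsilon> \<le> 1" using eps ke by linarith
        then have "m \<le> d" using \<open>0 < d\<close> by (simp add: m_def)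
        moreover have "3 * d \<le> 3 * real k * d" using k17 \<open>0 < d\<close> by simp
        ultimately show ?thesis using d102 by linarith
      qed
      ultimately have "real (card ?W) \<le> real k * (3 * real k * d)" using cM by (simp add: algebra_simps)
      also have "\<dots> \<le> real k * (real k * (3 * real k * d))" using k17 \<open>0 < d\<close> by (intro mult_left_mono) auto
      finally have "real (card ?W) \<le> 3 * real k ^ 3 * d" by (simp add: power3_eq_cube algebra_simps)
      then have "real (card (A \<inter> ?W \<times> ?W)) < m * m" using W(1) by (intro sparse) auto
      moreover have "m * m \<le> real (card M) * m" using cM m1 by (intro mult_right_mono) auto
      ultimately show False using W(3) by linarith
    qed
    have XD: "X \<subseteq> D" and degX: "\<And>y. y \<in> X \<Longrightarrow> \<delta> \<le> real (card (nbr y))"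
      by (auto simp: X_def)
    from star_minor[OF G XD large degX md few]
    obtain G2 :: "'a pair_pre_digraph" where G2: "pair_graph G2" "bounded_minor (T + r) G2 G"
      "(real r * (\<delta> - m) - m * (real r * (real r - 1) / 2) - 1) / 2 \<le> density G2"
      by blast
    have "real k / (8 * real l) * (1 - 2 * real k * \<epsilon>) * d \<le> real r / 2 * ((1 - 2 * real k * \<epsilon>) * d)"
    proof -
      have "real k / (8 * real l) \<le> real r / 2" using r_lower' assms(1) by (simp add: field_simps)
      then have "real k / (8 * real l) * ((1 - 2 * real k * \<epsilon>) * d) \<le> real r / 2 * ((1 - 2 * real k * \<epsilon>) * d)"
        using ke \<open>0 < d\<close> by (intro mult_right_mono) auto
      then show ?thesis by (simp add: mult.assoc)
    qed
    also have "\<dots> \<le> (real r * (\<delta> - m) - m * (real r * (real r - 1) / 2) - 1) / 2"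
    proof -
      have "8 * real r \<le> real k + 7"
      proof -
        have "8 * (real r - 1) \<le> 4 * real l * (real r - 1)"
          using assms(1) r0 by (intro mult_right_mono) auto
        then show ?thesis using r_upper' by (simp add: algebra_simps)
      qed
      moreover have "17 \<le> real k" using k17 by simp
      \<comment> \<open>Besides \<open>9 / 5 * real k\<close> from \<open>\<delta>\<close> and
        \<open>(real r - 1) / 2\<close> from overlaps, one unit of \<open>m\<close> is for
        neighbours outside the family and one absorbs the \<open>- 1\<close>, as
        \<open>real r * m\<close> is at least 1.\<close>
      ultimately have "9 / 5 * real k + 2 + (real r - 1) / 2 \<le> 2 * real k" by (simp add: field_simps)
      then have "(9 / 5 * real k + 2 + (real r - 1) / 2) * m \<le> 2 * real k * m"
        using m1 by (intro mult_right_mono) auto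
      then have "(1 - 2 * real k * \<epsilon>) * d \<le> \<delta> - m - (real r - 1) / 2 * m - m"
        by (simp add: \<delta>_def m_def field_simps)
      then have "real r * ((1 - 2 * real k * \<epsilon>) * d) \<le> real r * (\<delta> - m - (real r - 1) / 2 * m - m)"
        by (intro mult_left_mono) auto
      moreover have "1 \<le> real r * m" using r0 m1 mult_mono[of 1 "real r" 1 m] by simp
      ultimately show ?thesis by (simp add: algebra_simps)
    qed
    also have "\<dots> \<le> density G2" by (rule G2(3))
    finally show ?thesis using G2(1,2) T(3) by auto
  qed
qed

theorem theorem2p5:
  fixes k l :: nat and \<epsilon> d :: real and G :: "'a pair_pre_digraph"
  assumes "2 \<le> l" and "l \<le> k"
    and "0 < \<epsilon>" and "\<epsilon> < 1 / (6 * real k)"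
    and "pair_graph G"
    and "d = density G" and "d \<ge> 1 / \<epsilon>"
  shows "(\<exists>H :: 'a pair_pre_digraph. pair_graph H \<and> subgraph (with_proj H) (with_proj G) \<and>
            real (card (pverts H)) \<le> 3 * real k ^ 3 * d \<and>
            real (card (edges H)) \<ge> \<epsilon>\<^sup>2 * d\<^sup>2 / 2) \<or>
         (\<exists>G' :: 'a pair_pre_digraph. pair_graph G' \<and> bounded_minor (l + 1) G' G \<and>
            density G' \<ge> real l / 2 * (1 - 6 * real k * \<epsilon>) * d) \<or>
         (\<exists>G' :: 'a pair_pre_digraph. pair_graph G' \<and> bounded_minor k G' G \<and>
            density G' \<ge> real k / (8 * real l) * (1 - 2 * real k * \<epsilon>) * d)"
proof -
  have arcs: "simple_arcs (pverts G) (parcs G)"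
    using assms(5) by (simp add: pair_graph_iff_simple_arcs)
  interpret simple_arcs "pverts G" "parcs G" by (rule arcs)
  have "0 < d" using assms(3,7) by (meson divide_pos_pos less_le_trans zero_less_one)
  show ?thesis
  proof (cases "k \<le> 8 * l")
    case True
    \<comment> \<open>For such \<open>k\<close> the factor \<open>real k / (8 * real l)\<close> is
      at most 1, so \<open>G\<close> with singleton branch sets already gives (iii).\<close>
    have "bounded_minor k G G"
      unfolding bounded_minor_def minor_model_def
    proof (intro exI[of _ "\<lambda>x. {x}"] conjI)
      show "\<forall>x\<in>pverts G. {x} \<subseteq> pverts G \<and> Digraph_Component.connected (with_proj G \<restriction> {x})"
        using tree_sets_connected[OF tree_sets.singleton order_refl] by auto
      show "\<forall>x\<in>pverts G. card {x} \<le> k" using assms(1,2) by simp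
    qed (auto simp: disjoint_family_on_def)
    moreover have "real k / (8 * real l) * (1 - 2 * real k * \<epsilon>) * d \<le> 1 * 1 * d"
    proof (intro mult_right_mono mult_mono)
      show "real k / (8 * real l) \<le> 1" using True assms(1) by simp
      show "0 \<le> 1 - 2 * real k * \<epsilon>" using assms(1-4) by (simp add: field_simps)
    qed (use \<open>0 < d\<close> assms(3) in auto)
    ultimately show ?thesis using assms(5,6) by auto
  next
    case False
    have "pverts G \<noteq> {}" using \<open>0 < d\<close> assms(6) by (auto simp: density_def)
    then have "0 < card (pverts G)" using finite_V by (simp add: card_gt_0_iff)
    then have "2 * d * real (card (pverts G)) \<le> real (card (parcs G))"
      using assms(6) density_eq_arcs[OF assms(5)] by simp
    from minimal_dense_subgraph[OF arcs \<open>pverts G \<noteq> {}\<close> \<open>0 < d\<close> this]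
    obtain V A where VA: "simple_arcs V A" "V \<subseteq> pverts G" "A \<subseteq> parcs G" "V \<noteq> {}"
      "2 * d * real (card V) \<le> real (card A)" "real (card A) < 2 * d * real (card V) + 2"
      "\<And>x. x \<in> V \<Longrightarrow> d < real (card (A `` {x}))" by metis
    show ?thesis
      using simple_arcs.sparse_trichotomy[OF VA(1) assms(1) _ assms(3,4,7,5) VA(2-7)] False by auto
  qed
qed

end
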